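(* Consider solutions $(\eta^k,\varrho^k,\mathbf u^k)_{k}$ of the fully discrete scheme (F1)--(F2) described in the context. Let $\theta\in[0,\frac13)$ and let $C>0$ be a constant, depending only on the energy bounds and $\theta$, such that $\max_k\|\eta^k-\eta^{k-1}\|_{L^\infty(\Sigma)}\le C\tau^\theta$. (i) Let $\tau^\theta\le\frac{\delta_0}{C}$ and $\delta_1\ge2\delta_0$. If for some $k\in\{0,\dots,N_T-1\}$ one has $\inf_\Sigma\eta^k\ge\delta_1-H$, then $\inf_\Sigma\eta^{k+1}\ge\delta_1-\delta_0-H$. (ii) Moreover, for every $\delta_0\in(0,H/2)$ there exists $T_0>0$, depending (besides $\delta_0$) only on the bounds of the energy inequality and $H$, such that $\inf_{[0,T_0]\times\Sigma}\eta_{h,\tau}(t,r)\ge\delta_0-H$, where $\eta_{h,\tau}(t)=\eta^k$ for $t\in[k\tau,(k+1)\tau)$.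
   Context: Geometry, time grid, laws. $d\in\{2,3\}$, $H>0$, $\Sigma=[0,L_1]\times\cdots\times[0,L_{d-1}]$, $\widehat\Omega=\Sigma\times[0,H]$, points $x=(r,x_d)$. $T>0$, $N_T\in\mathbb N$, $\tau=T/N_T$, $t^k=k\tau$, $I^k=[t^k,t^{k+1})$. $a>0,\gamma>1,\mu>0,\mu+\lambda\ge0,\alpha>0,\beta\ge0$; $p(\varrho)=a\varrho^\gamma$, $\mathbf D(\mathbf u)$ is the (elementwise) symmetric gradient. $\mathbf f,g$ and the initial data $\varrho_0,\mathbf u_0$ are given. Mesh. $\mathcal T_h^0$ is a shape-regular, quasi-uniform conforming simplicial mesh of $\widehat\Omega$ of size $h$, built by extending a $(d-1)$-dimensional mesh of the bottom surface in the $d$-th direction; $\Sigma_h$ is the induced mesh of $\Sigma$ (top faces). $\Pi_p$ is the continuous piecewise linear interpolation on $\Sigma_h$ at its vertices. For a displacement $\eta^k$ with $H+\Pi_p\eta^k>0$: $\mathcal A^k(\hat r,\hat x_d)=\big(\hat r,\frac{\Pi_p\eta^k(\hat r)+H}{H}\hat x_d\big)$, $\Omega^k=\mathcal A^k(\widehat\Omega)$, $\mathcal T_h^k=\mathcal A^k(\mathcal T_h^0)$, the latter assumed to be conforming simplicial meshes regular uniformly in $k,h,\tau$. $X_k^{k-1}=\mathcal A^{k-1}\circ(\mathcal A^k)^{-1}$, $\mathcal F_k^{k-1}=\frac{\Pi_p\eta^{k-1}+H}{\Pi_p\eta^k+H}$. $\mathcal E_I^k,\mathcal E_E^k$ are the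 interior/exterior faces of $\mathcal T_h^k$; top faces are those lying on the image of $\Sigma\times\{H\}$; $\mathcal E(K)$ the faces of $K$; $\mathbf n$ the outer normal. On a face: $v^{\rm out/in}=\lim_{\delta\to0^+}v(x\pm\delta\mathbf n)$, $[\![v]\!]=v^{\rm out}-v^{\rm in}$, $\langle v\rangle_\sigma=\frac1{|\sigma|}\int_\sigma v\,dS$; outer values on exterior faces are set by the boundary conditions. $f^\pm=\frac12(f\pm|f|)$. Spaces. $\widehat Q_h$: piecewise constants on $\mathcal T_h^0$; $\widehat V_h$: ($\mathbb R^d$-valued) Crouzeix--Raviart functions (elementwise affine, $\int_\sigma[\![v]\!]=0$ on interior faces); $W_h$: functions in $C^1(\Sigma)$ that are quadratic on each cell of $\Sigma_h$, subject to the clamped conditions $\eta=0,\nabla\eta=0$ on $\partial\Sigma$. $Q_h(\Omega^k)=\widehat Q_h\circ(\mathcal A^k)^{-1}$, $V_h(\Omega^k)=\widehat V_h\circ(\mathcal A^k)^{-1}$. $\Pi_{\mathcal T}[v]|_K=\frac1{|K|}\int_Kv$; $\Pi_{\mathcal E}$ is the Crouzeix--Raviart interpolation ($\int_\sigma\Pi_{\mathcal E}[v]=\int_\sigma v$). $\nabla_h,\mathrm{div}_h$ are elementwise. Differences and velocities. $\delta_tr^k=(r^k-r^{k-1})/\tau$; $D_tr^k=\frac{r^k-(r^{k-1}\circ X_k^{k-1})\mathcal F_k^{k-1}}\tau$; $z^k=\delta_t\eta^k$; $\mathbf w^k=\big(\mathbf0_{d-1},\frac{\Pi_p[z^k]\,x_d}{\Pi_p[\eta^k]+H}\big)^T$;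 $\mathbf v^k=\mathbf u^k-\mathbf w^k$. Upwind divergence. $\mathrm{Div}^{\rm up}(r,\mathbf v)|_K=\frac1{|K|}\sum_{\sigma\in\mathcal E(K)}\int_\sigma\big(r^{\rm in}\langle\mathbf v\cdot\mathbf n\rangle_\sigma^++r^{\rm out}\langle\mathbf v\cdot\mathbf n\rangle_\sigma^--h^\varepsilon[\![r]\!]\big)dS$, $\varepsilon>-1$. Fully discrete scheme. For $k=1,\dots,N_T$ find $(\eta^k,\varrho^k,\mathbf u^k)\in W_h\times Q_h(\Omega^k)\times V_h(\Omega^k)$ such that for all $(\varphi,\boldsymbol\Psi,\psi)\in Q_h(\Omega^k)\times V_h(\Omega^k)\times W_h$ with $\langle\boldsymbol\Psi\rangle_\sigma=\langle\Pi_p\psi\rangle_\sigma\mathbf e_d$ on top faces ($\psi$ viewed as a function of $r$, $\mathbf e_d$ the $d$-th unit vector) and $\langle\boldsymbol\Psi\rangle_\sigma=0$ on the other exterior faces: (F1) $\int_{\Omega^k}D_t\varrho^k\varphi\,dx+\int_{\Omega^k}\mathrm{Div}^{\rm up}(\varrho^k,\mathbf v^k)\varphi\,dx=0$; (F2) $\int_{\Omega^k}\big(D_t(\varrho^k\Pi_{\mathcal T}[\mathbf u^k])+\mathrm{Div}^{\rm up}(\varrho^k\Pi_{\mathcal T}[\mathbf u^k],\mathbf v^k)\big)\cdot\boldsymbol\Psi\,dx+2\mu\int_{\Omega^k}\mathbf D(\mathbf u^k):\nabla_h\boldsymbol\Psi\,dx+2\mu\sum_{\sigma\in\mathcal E_I^k}\int_\sigma\frac1h[\![\mathbf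 u^k]\!]\cdot[\![\boldsymbol\Psi]\!]dS+\lambda\int_{\Omega^k}\mathrm{div}_h\mathbf u^k\mathrm{div}_h\boldsymbol\Psi\,dx-\int_{\Omega^k}p(\varrho^k)\mathrm{div}_h\boldsymbol\Psi\,dx+\int_\Sigma\delta_tz^k\psi\,dr+\alpha\int_\Sigma\Delta\eta^k\Delta\psi\,dr+\beta\int_\Sigma\nabla\eta^k\cdot\nabla\psi\,dr=\int_{\Omega^k}\varrho^k\mathbf f^k\cdot\boldsymbol\Psi\,dx+\int_\Sigma g^k\psi\,dr$, with $\mathbf f^k=\frac1\tau\int_{I^k}\Pi_{\mathcal E}[\mathbf f]dt$, $g^k=\frac1\tau\int_{I^k}\Pi_{\mathcal E}[g]dt$, $\varrho^0=\Pi_{\mathcal T}[\varrho_0]$, $\mathbf u^0=\Pi_{\mathcal T}[\mathbf u_0]$, $\eta^0=0$, $z^0=0$, and $\langle\mathbf v^k\rangle_\sigma=0$, $[\![\varrho^k]\!]_\sigma=0$ for exterior faces $\sigma$. "Energy bounds": a constant independent of $h,\tau$ (depending on the initial data and on $\mathbf f,g$) bounding in particular $\max_k\|z^k\|_{L^2(\Sigma)}$, $\max_k\|\Delta\eta^k\|_{L^2(\Sigma)}$, $\max_k\|\nabla\eta^k\|_{L^2(\Sigma)}$, $\|\varrho\|_{L^\infty L^\gamma}$, $\|\nabla_h\mathbf u\|_{L^2L^2}$, $\|\mathbf u\|_{L^2L^6}$. For every $\theta\in[0,\frac13)$ a constant $C$ as in the claim exists. Times are understood within the interval $[0,T]$ of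 the scheme. *)

theory Defs
  imports "HOL-Analysis.Analysis" "HOL-Probability.Essential_Supremum"
begin

text \<open>The horizontal variable \<open>r\<close> ranges over a Euclidean space \<open>'a\<close> of dimension
  \<open>d - 1\<close>, and points \<open>(r, x\<^sub>d)\<close> of the fluid domain live in \<open>'a \<times> real\<close>.\<close>

type_synonym 'a pt = "'a \<times> real"

subsection \<open>Norms\<close>

definition Lp_norm :: "real \<Rightarrow> 'b::euclidean_space set \<Rightarrow> ('b \<Rightarrow> 'v::real_normed_vector) \<Rightarrow> real"
  where "Lp_norm p A v = (LINT x:A|lebesgue. norm (v x) powr p) powr (1 / p)"

definition Linf_norm :: "'b::euclidean_space set \<Rightarrow> ('b \<Rightarrow> real) \<Rightarrow> ereal"
  where "Linf_norm A v = esssup (restrict_space lebesgue A) (\<lambda>x. ereal \<bar>v x\<bar>)"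

subsection \<open>Surface measure\<close>

text \<open>The surface element \<open>dS\<close> is the Hausdorff measure of codimension 1, normalised so that the
  \<open>n\<close>-dimensional Hausdorff measure agrees with Lebesgue measure on \<open>n\<close>-planes. Dimension 0 gives
  the counting measure (this is why the empty set has to be treated separately).
  The completion makes values on null sets, such as edges of faces, irrelevant.\<close>

definition hausdorff_premeasure :: "nat \<Rightarrow> real \<Rightarrow> 'b::euclidean_space set \<Rightarrow> ennreal"
  where "hausdorff_premeasure n \<delta> A =
    (INF C\<in>{C :: nat \<Rightarrow> 'b set. A \<subseteq> (\<Union>i. C i) \<and> (\<forall>i. bounded (C i) \<and> diameter (C i) < \<delta>)}.
      \<Sum>i. if C i = {} then 0 else ennreal (unit_ball_vol (real n) * (diameter (C i) / 2) ^ n))"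

definition hausdorff_outer :: "nat \<Rightarrow> 'b::euclidean_space set \<Rightarrow> ennreal"
  where "hausdorff_outer n A = (SUP \<delta>\<in>{0<..}. hausdorff_premeasure n \<delta> A)"

definition hausdorff_measure :: "nat \<Rightarrow> 'b::euclidean_space measure"
  where "hausdorff_measure n = measure_of UNIV (sets borel) (hausdorff_outer n)"

definition surface :: "'b::euclidean_space measure"
  where "surface = completion (hausdorff_measure (DIM('b) - 1))"

definition surf_int :: "'b::euclidean_space set \<Rightarrow> ('b \<Rightarrow> 'v::{banach,second_countable_topology}) \<Rightarrow> 'v"
  where "surf_int \<sigma> v = (LINT x:\<sigma>|surface. v x)"

definition face_mean :: "'b::euclidean_space set \<Rightarrow> ('b \<Rightarrow> 'v::{banach,second_countable_topology}) \<Rightarrow> 'v"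
  where "face_mean \<sigma> v = surf_int \<sigma> v /\<^sub>R measure surface \<sigma>"

subsection \<open>Normals, traces, jumps\<close>

text \<open>The outer unit normal of \<open>K\<close> at \<open>x\<close> is the unit vector whose half space
  \<open>{v. v \<bullet> n \<le> 0}\<close> contains the tangent cone of \<open>K\<close> at \<open>x\<close>. It is unique at the points of the
  relative interior of a (flat or smoothly curved) face of \<open>K\<close>.\<close>

definition outer_normal :: "'b::euclidean_space set \<Rightarrow> 'b \<Rightarrow> 'b"
  where "outer_normal K x = (THE n. norm n = 1 \<and>
    (\<forall>e>0. \<forall>\<^sub>F y in at x within K. (y - x) \<bullet> n \<le> e * norm (y - x)))"

definition trace_in :: "'b::euclidean_space set \<Rightarrow> ('b \<Rightarrow> 'v::t2_space) \<Rightarrow> 'b \<Rightarrow> 'v"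
  where "trace_in K v x = Lim (at_right 0) (\<lambda>\<delta>. v (x - \<delta> *\<^sub>R outer_normal K x))"

definition trace_out :: "'b::euclidean_space set \<Rightarrow> ('b \<Rightarrow> 'v::t2_space) \<Rightarrow> 'b \<Rightarrow> 'v"
  where "trace_out K v x = Lim (at_right 0) (\<lambda>\<delta>. v (x + \<delta> *\<^sub>R outer_normal K x))"

definition jump :: "'b::euclidean_space set \<Rightarrow> ('b \<Rightarrow> 'v::real_normed_vector) \<Rightarrow> 'b \<Rightarrow> 'v"
  where "jump K v x = trace_out K v x - trace_in K v x"

definition pos_part :: "real \<Rightarrow> real" where "pos_part q = (q + \<bar>q\<bar>) / 2"

definition neg_part :: "real \<Rightarrow> real" where "neg_part q = (q - \<bar>q\<bar>) / 2"

subsection \<open>Elementwise differential operators\<close>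

text \<open>Discrete functions are smooth in the interior of each element, so the elementwise derivatives
  are the classical derivatives outside the (null) mesh skeleton, on which their values are
  irrelevant. For \<open>C\<^sup>1\<close> piecewise quadratic functions, \<open>laplacian\<close> below is also the weak
  Laplacian, since the gradient has no jumps.\<close>

definition pd :: "'b \<Rightarrow> ('b::euclidean_space \<Rightarrow> 'v::real_normed_vector) \<Rightarrow> 'b \<Rightarrow> 'v"
  where "pd i v x = frechet_derivative v (at x) i"

definition grad :: "('b::euclidean_space \<Rightarrow> real) \<Rightarrow> 'b \<Rightarrow> 'b"
  where "grad v x = (\<Sum>i\<in>Basis. pd i v x *\<^sub>R i)"

definition laplacian :: "('b::euclidean_space \<Rightarrow> real) \<Rightarrow> 'b \<Rightarrow> real"
  where "laplacian v x = (\<Sum>i\<in>Basis. pd i (pd i v) x)"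

definition divergence :: "('b::euclidean_space \<Rightarrow> 'b) \<Rightarrow> 'b \<Rightarrow> real"
  where "divergence v x = (\<Sum>i\<in>Basis. pd i v x \<bullet> i)"

definition sym_grad :: "('b::euclidean_space \<Rightarrow> 'b) \<Rightarrow> 'b \<Rightarrow> 'b \<Rightarrow> 'b \<Rightarrow> real"
  where "sym_grad v x i j = (pd j v x \<bullet> i + pd i v x \<bullet> j) / 2"

definition jacobian_norm :: "('b::euclidean_space \<Rightarrow> 'b) \<Rightarrow> 'b \<Rightarrow> real"
  where "jacobian_norm v x = sqrt (\<Sum>i\<in>Basis. \<Sum>j\<in>Basis. (pd j v x \<bullet> i)\<^sup>2)"

subsection \<open>Meshes and finite element spaces\<close>

definition conforming_mesh :: "'b::euclidean_space set set \<Rightarrow> 'b set \<Rightarrow> bool"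
  where "conforming_mesh \<T> D \<longleftrightarrow>
    triangulation \<T> \<and> (\<forall>K\<in>\<T>. int DIM('b) simplex K) \<and> \<Union>\<T> = D"

definition vertices :: "'b::euclidean_space set \<Rightarrow> 'b set"
  where "vertices K = {x. x extreme_point_of K}"

definition faces :: "'b::euclidean_space set set \<Rightarrow> 'b set set"
  where "faces \<T> = {F. \<exists>K\<in>\<T>. F facet_of K}"

definition interior_faces :: "'b::euclidean_space set set \<Rightarrow> 'b set set"
  where "interior_faces \<T> = {F. \<exists>K\<in>\<T>. \<exists>K'\<in>\<T>. K \<noteq> K' \<and> F facet_of K \<and> F facet_of K'}"

definition exterior_faces :: "'b::euclidean_space set set \<Rightarrow> 'b set set"
  where "exterior_faces \<T> = faces \<T> - interior_faces \<T>"

text \<open>An element having \<open>F\<close> as a face; it fixes the orientation of the normal on \<open>F\<close>.\<close>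

definition owner :: "'b::euclidean_space set set \<Rightarrow> 'b set \<Rightarrow> 'b set"
  where "owner \<T> F = (SOME K. K \<in> \<T> \<and> F facet_of K)"

definition shape_regular :: "real \<Rightarrow> 'b::euclidean_space set \<Rightarrow> bool"
  where "shape_regular \<kappa> K \<longleftrightarrow> (\<exists>c. cball c (\<kappa> * diameter K) \<subseteq> K)"

text \<open>Deformed meshes are given by a simplicial reference mesh \<open>\<T>\<close> and a map \<open>A\<close>: the elements are
  the images \<open>A ` K\<close> with \<open>K \<in> \<T>\<close>, the faces the images \<open>A ` F\<close> with \<open>F \<in> faces \<T>\<close>.
  The definitions below make sense whether or not these images are flat.\<close>

definition ref_cell :: "('b \<Rightarrow> 'b) \<Rightarrow> 'b::euclidean_space set set \<Rightarrow> 'b \<Rightarrow> 'b set"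
  where "ref_cell A \<T> x = (SOME K. K \<in> \<T> \<and> x \<in> interior (A ` K))"

definition Pi_T :: "('b \<Rightarrow> 'b) \<Rightarrow> 'b::euclidean_space set set \<Rightarrow> ('b \<Rightarrow> 'v::{banach,second_countable_topology}) \<Rightarrow> 'b \<Rightarrow> 'v"
  where "Pi_T A \<T> v x = (let K = A ` ref_cell A \<T> x in
    (LINT y:K|lebesgue. v y) /\<^sub>R measure lebesgue K)"

definition pw_const :: "'b::euclidean_space set set \<Rightarrow> ('b \<Rightarrow> real) set"
  where "pw_const \<T> = {q. \<forall>K\<in>\<T>. \<exists>c. \<forall>x\<in>interior K. q x = c}"

definition crouzeix_raviart :: "'b::euclidean_space set set \<Rightarrow> ('b \<Rightarrow> 'v::euclidean_space) set"
  where "crouzeix_raviart \<T> = {v.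
    (\<forall>K\<in>\<T>. \<exists>B c. linear B \<and> (\<forall>x\<in>interior K. v x = B x + c)) \<and>
    (\<forall>F\<in>interior_faces \<T>. surf_int F (jump (owner \<T> F) v) = 0)}"

text \<open>\<open>transport A D X\<close> is the space \<open>X \<circ> A\<^sup>-\<^sup>1\<close>; only values on \<open>A ` D\<close> count.\<close>

definition transport :: "('b \<Rightarrow> 'b) \<Rightarrow> 'b set \<Rightarrow> ('b \<Rightarrow> 'v) set \<Rightarrow> ('b \<Rightarrow> 'v) set"
  where "transport A D X = {v. \<exists>w\<in>X. \<forall>x\<in>A ` D. v x = w (inv_into D A x)}"

text \<open>The mean over \<open>A ` F\<close> is prescribed from the side of the owner, which suffices because
  Crouzeix--Raviart functions have the same mean from both sides of a flat face.\<close>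

definition Pi_E :: "('b \<Rightarrow> 'b) \<Rightarrow> 'b::euclidean_space set set \<Rightarrow> ('b \<Rightarrow> 'v::euclidean_space) \<Rightarrow> 'b \<Rightarrow> 'v"
  where "Pi_E A \<T> v = (SOME w. w \<in> transport A (\<Union>\<T>) (crouzeix_raviart \<T>) \<and>
    (\<forall>F\<in>faces \<T>. surf_int (A ` F) (trace_in (A ` owner \<T> F) w) = surf_int (A ` F) v))"

definition Pi_p :: "'a::euclidean_space set set \<Rightarrow> ('a \<Rightarrow> real) \<Rightarrow> 'a \<Rightarrow> real"
  where "Pi_p \<S> \<eta> r = (THE y. \<exists>S\<in>\<S>. \<exists>b c. r \<in> S \<and> (\<forall>s\<in>vertices S. b \<bullet> s + c = \<eta> s) \<and> y = b \<bullet> r + c)"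

definition clamped_quadratic :: "'a::euclidean_space set set \<Rightarrow> 'a set \<Rightarrow> ('a \<Rightarrow> real) set"
  where "clamped_quadratic \<S> D = {\<eta>.
    (\<exists>G. continuous_on D G \<and> (\<forall>r\<in>D. (\<eta> has_derivative (\<lambda>s. G r \<bullet> s)) (at r within D)) \<and>
         (\<forall>r\<in>frontier D. \<eta> r = 0 \<and> G r = 0)) \<and>
    (\<forall>S\<in>\<S>. \<exists>B b c. linear B \<and> (\<forall>r\<in>S. \<eta> r = r \<bullet> B r + b \<bullet> r + c))}"

text \<open>Outer values on exterior faces are the inner ones (zero jump), as required of the density
  by the boundary conditions; with \<open>\<langle>v\<rangle> = 0\<close> there is thus no upwind flux through the boundary.\<close>

definition Div_up :: "('b \<Rightarrow> 'b) \<Rightarrow> 'b::euclidean_space set set \<Rightarrow> real \<Rightarrow> real \<Rightarrow>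
    ('b \<Rightarrow> 'v::euclidean_space) \<Rightarrow> ('b \<Rightarrow> 'b) \<Rightarrow> 'b \<Rightarrow> 'v"
  where "Div_up A \<T> h \<epsilon> q v x = (let K0 = ref_cell A \<T> x; K = A ` K0 in
    (\<Sum>F | F facet_of K0.
       let vn = face_mean (A ` F) (\<lambda>y. trace_in K v y \<bullet> outer_normal K y) in
       surf_int (A ` F) (\<lambda>y.
         let q_in = trace_in K q y;
             q_out = (if F \<in> exterior_faces \<T> then q_in else trace_out K q y)
         in pos_part vn *\<^sub>R q_in + neg_part vn *\<^sub>R q_out - (h powr \<epsilon>) *\<^sub>R (q_out - q_in)))
    /\<^sub>R measure lebesgue K)"

subsection \<open>The problem, its discretisation, and the unknowns\<close>

record 'a problem =
  side_lengths :: 'a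
  height :: real
  final_time :: real
  pressure_coeff :: real
  adiabatic_exp :: real
  visc_mu :: real
  visc_lambda :: real
  plate_alpha :: real
  plate_beta :: real
  body_force :: "real \<Rightarrow> 'a pt \<Rightarrow> 'a pt"
  plate_load :: "real \<Rightarrow> 'a \<Rightarrow> real"
  init_density :: "'a pt \<Rightarrow> real"
  init_velocity :: "'a pt \<Rightarrow> 'a pt"

record 'a discretisation =
  num_steps :: nat
  mesh_size :: real
  ref_mesh :: "'a pt set set"
  regularity :: real
  upwind_eps :: real

record 'a unknowns =
  displ :: "nat \<Rightarrow> 'a \<Rightarrow> real"
  dens :: "nat \<Rightarrow> 'a pt \<Rightarrow> real"
  vel :: "nat \<Rightarrow> 'a pt \<Rightarrow> 'a pt"

definition admissible_problem :: "'a::euclidean_space problem \<Rightarrow> bool"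
  where "admissible_problem P \<longleftrightarrow>
    (\<forall>i\<in>Basis. 0 < side_lengths P \<bullet> i) \<and> 0 < height P \<and> 0 < final_time P \<and>
    0 < pressure_coeff P \<and> 1 < adiabatic_exp P \<and> 0 < visc_mu P \<and> 0 \<le> visc_mu P + visc_lambda P \<and>
    0 < plate_alpha P \<and> 0 \<le> plate_beta P"

definition plate :: "'a::euclidean_space problem \<Rightarrow> 'a set"
  where "plate P = cbox 0 (side_lengths P)"

definition ref_domain :: "'a::euclidean_space problem \<Rightarrow> 'a pt set"
  where "ref_domain P = plate P \<times> {0..height P}"

definition pressure :: "'a problem \<Rightarrow> real \<Rightarrow> real"
  where "pressure P \<rho> = pressure_coeff P * \<rho> powr adiabatic_exp P"

definition step :: "'a problem \<Rightarrow> 'a discretisation \<Rightarrow> real"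
  where "step P M = final_time P / real (num_steps M)"

definition top_faces :: "'a::euclidean_space problem \<Rightarrow> 'a discretisation \<Rightarrow> 'a pt set set"
  where "top_faces P M = {F \<in> faces (ref_mesh M). F \<subseteq> plate P \<times> {height P}}"

definition plate_mesh :: "'a::euclidean_space problem \<Rightarrow> 'a discretisation \<Rightarrow> 'a set set"
  where "plate_mesh P M = (\<lambda>F. fst ` F) ` top_faces P M"

text \<open>The last condition says that the mesh is obtained by extending a mesh of the plate
  vertically: every element lies in the column over one plate cell and has its vertices above
  the vertices of that cell.\<close>

definition admissible_discretisation :: "'a::euclidean_space problem \<Rightarrow> 'a discretisation \<Rightarrow> bool"
  where "admissible_discretisation P M \<longleftrightarrow>
    0 < num_steps M \<and> -1 < upwind_eps M \<and> 0 < regularity M \<and>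
    conforming_mesh (ref_mesh M) (ref_domain P) \<and>
    mesh_size M = Max (diameter ` ref_mesh M) \<and>
    (\<forall>K\<in>ref_mesh M. regularity M * mesh_size M \<le> diameter K \<and> shape_regular (regularity M) K) \<and>
    (\<forall>K\<in>ref_mesh M. \<exists>S\<in>plate_mesh P M. fst ` vertices K = vertices S)"

context
  fixes P :: "'a::euclidean_space problem" and M :: "'a discretisation" and U :: "'a unknowns"
begin

definition interp_displ :: "nat \<Rightarrow> 'a \<Rightarrow> real"
  where "interp_displ k = Pi_p (plate_mesh P M) (displ U k)"

definition ale_map :: "nat \<Rightarrow> 'a pt \<Rightarrow> 'a pt"
  where "ale_map k = (\<lambda>(r, y). (r, (interp_displ k r + height P) / height P * y))"

definition fluid_domain :: "nat \<Rightarrow> 'a pt set"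
  where "fluid_domain k = ale_map k ` ref_domain P"

definition back_map :: "nat \<Rightarrow> 'a pt \<Rightarrow> 'a pt"
  where "back_map k = ale_map (k - 1) \<circ> inv_into (ref_domain P) (ale_map k)"

definition jac_ratio :: "nat \<Rightarrow> 'a pt \<Rightarrow> real"
  where "jac_ratio k x = (interp_displ (k - 1) (fst x) + height P) / (interp_displ k (fst x) + height P)"

definition Qh :: "nat \<Rightarrow> ('a pt \<Rightarrow> real) set"
  where "Qh k = transport (ale_map k) (ref_domain P) (pw_const (ref_mesh M))"

definition Vh :: "nat \<Rightarrow> ('a pt \<Rightarrow> 'a pt) set"
  where "Vh k = transport (ale_map k) (ref_domain P) (crouzeix_raviart (ref_mesh M))"

definition Wh :: "('a \<Rightarrow> real) set"
  where "Wh = clamped_quadratic (plate_mesh P M) (plate P)"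

definition plate_vel :: "nat \<Rightarrow> 'a \<Rightarrow> real"
  where "plate_vel k r = (if k = 0 then 0 else (displ U k r - displ U (k - 1) r) / step P M)"

definition plate_acc :: "nat \<Rightarrow> 'a \<Rightarrow> real"
  where "plate_acc k r = (plate_vel k r - plate_vel (k - 1) r) / step P M"

definition mesh_vel :: "nat \<Rightarrow> 'a pt \<Rightarrow> 'a pt"
  where "mesh_vel k x = (0, Pi_p (plate_mesh P M) (plate_vel k) (fst x) * snd x /
    (interp_displ k (fst x) + height P))"

definition rel_vel :: "nat \<Rightarrow> 'a pt \<Rightarrow> 'a pt"
  where "rel_vel k x = vel U k x - mesh_vel k x"

definition D_t :: "(nat \<Rightarrow> 'a pt \<Rightarrow> 'v::real_vector) \<Rightarrow> nat \<Rightarrow> 'a pt \<Rightarrow> 'v"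
  where "D_t q k x = (q k x - jac_ratio k x *\<^sub>R q (k - 1) (back_map k x)) /\<^sub>R step P M"

definition momentum :: "nat \<Rightarrow> 'a pt \<Rightarrow> 'a pt"
  where "momentum k x = dens U k x *\<^sub>R Pi_T (ale_map k) (ref_mesh M) (vel U k) x"

definition force_k :: "nat \<Rightarrow> 'a pt \<Rightarrow> 'a pt"
  where "force_k k x = (LINT t:{real k * step P M..<real (k + 1) * step P M}|lebesgue.
    Pi_E (ale_map k) (ref_mesh M) (body_force P t) x) /\<^sub>R step P M"

definition load_k :: "nat \<Rightarrow> 'a \<Rightarrow> real"
  where "load_k k r = (LINT t:{real k * step P M..<real (k + 1) * step P M}|lebesgue.
    Pi_E id (plate_mesh P M) (plate_load P t) r) / step P M"

definition bdry_mean :: "nat \<Rightarrow> ('a pt \<Rightarrow> 'a pt) \<Rightarrow> 'a pt set \<Rightarrow> 'a pt"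
  where "bdry_mean k v F = face_mean (ale_map k ` F) (trace_in (ale_map k ` owner (ref_mesh M) F) v)"

definition test_pair :: "nat \<Rightarrow> ('a pt \<Rightarrow> 'a pt) \<Rightarrow> ('a \<Rightarrow> real) \<Rightarrow> bool"
  where "test_pair k \<Psi> \<psi> \<longleftrightarrow> \<Psi> \<in> Vh k \<and> \<psi> \<in> Wh \<and>
    (\<forall>F\<in>exterior_faces (ref_mesh M). bdry_mean k \<Psi> F =
      (if F \<in> top_faces P M
       then (0, face_mean (ale_map k ` F) (\<lambda>x. Pi_p (plate_mesh P M) \<psi> (fst x)))
       else 0))"

definition continuity_eq :: "nat \<Rightarrow> bool"
  where "continuity_eq k \<longleftrightarrow> (\<forall>\<phi>\<in>Qh k.
    (LINT x:fluid_domain k|lebesgue. D_t (dens U) k x * \<phi> x) +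
    (LINT x:fluid_domain k|lebesgue.
       Div_up (ale_map k) (ref_mesh M) (mesh_size M) (upwind_eps M) (dens U k) (rel_vel k) x * \<phi> x) = 0)"

definition momentum_eq :: "nat \<Rightarrow> bool"
  where "momentum_eq k \<longleftrightarrow> (\<forall>\<Psi> \<psi>. test_pair k \<Psi> \<psi> \<longrightarrow>
    (LINT x:fluid_domain k|lebesgue.
       (D_t momentum k x +
        Div_up (ale_map k) (ref_mesh M) (mesh_size M) (upwind_eps M) (momentum k) (rel_vel k) x) \<bullet> \<Psi> x) +
    2 * visc_mu P * (LINT x:fluid_domain k|lebesgue.
       \<Sum>i\<in>Basis. \<Sum>j\<in>Basis. sym_grad (vel U k) x i j * (pd j \<Psi> x \<bullet> i)) +
    2 * visc_mu P * (\<Sum>F\<in>interior_faces (ref_mesh M). surf_int (ale_map k ` F) (\<lambda>x.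
       1 / mesh_size M * (jump (ale_map k ` owner (ref_mesh M) F) (vel U k) x \<bullet>
                          jump (ale_map k ` owner (ref_mesh M) F) \<Psi> x))) +
    visc_lambda P * (LINT x:fluid_domain k|lebesgue. divergence (vel U k) x * divergence \<Psi> x) -
    (LINT x:fluid_domain k|lebesgue. pressure P (dens U k x) * divergence \<Psi> x) +
    (LINT r:plate P|lebesgue. plate_acc k r * \<psi> r) +
    plate_alpha P * (LINT r:plate P|lebesgue. laplacian (displ U k) r * laplacian \<psi> r) +
    plate_beta P * (LINT r:plate P|lebesgue. grad (displ U k) r \<bullet> grad \<psi> r) =
    (LINT x:fluid_domain k|lebesgue. dens U k x * (force_k k x \<bullet> \<Psi> x)) +
    (LINT r:plate P|lebesgue. load_k k r * \<psi> r))"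

definition initial_conditions :: bool
  where "initial_conditions \<longleftrightarrow>
    (\<forall>r\<in>plate P. displ U 0 r = 0) \<and>
    (\<forall>K\<in>ref_mesh M. \<forall>x\<in>interior (ale_map 0 ` K).
       dens U 0 x = Pi_T (ale_map 0) (ref_mesh M) (init_density P) x \<and>
       vel U 0 x = Pi_T (ale_map 0) (ref_mesh M) (init_velocity P) x)"

text \<open>The images of the simplices under \<open>ale_map k\<close> are in general curved, because \<open>ale_map k\<close> is
  only affine in each variable separately (on each plate cell). They inherit conformity from the
  reference mesh. Shape regularity is required with the constant \<open>regularity M\<close>, which does not
  depend on \<open>k\<close>; flatness is not required.\<close>

definition solves_scheme :: bool
  where "solves_scheme \<longleftrightarrow>
    admissible_problem P \<and> admissible_discretisation P M \<and>
    (\<forall>k\<le>num_steps M.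
       displ U k \<in> Wh \<and> (\<forall>r\<in>plate P. 0 < interp_displ k r + height P) \<and>
       (\<forall>K\<in>ref_mesh M. shape_regular (regularity M) (ale_map k ` K))) \<and>
    initial_conditions \<and>
    (\<forall>k\<in>{1..num_steps M}.
       dens U k \<in> Qh k \<and> vel U k \<in> Vh k \<and>
       (\<forall>F\<in>exterior_faces (ref_mesh M). bdry_mean k (rel_vel k) F = 0) \<and>
       continuity_eq k \<and> momentum_eq k)"

text \<open>The space-time norms are those of the functions that are piecewise constant in time; the
  \<open>L\<^sup>2\<close> norms in time involve the computed steps \<open>1, \<dots>, N\<^sub>T\<close>, as in the discrete energy balance.\<close>

definition energy_bounds :: "real \<Rightarrow> bool"
  where "energy_bounds E \<longleftrightarrow>
    (\<forall>k\<le>num_steps M.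
       Lp_norm 2 (plate P) (plate_vel k) \<le> E \<and>
       Lp_norm 2 (plate P) (laplacian (displ U k)) \<le> E \<and>
       Lp_norm 2 (plate P) (grad (displ U k)) \<le> E \<and>
       Lp_norm (adiabatic_exp P) (fluid_domain k) (dens U k) \<le> E) \<and>
    sqrt (\<Sum>k=1..num_steps M. step P M * (Lp_norm 2 (fluid_domain k) (jacobian_norm (vel U k)))\<^sup>2) \<le> E \<and>
    sqrt (\<Sum>k=1..num_steps M. step P M * (Lp_norm 6 (fluid_domain k) (vel U k))\<^sup>2) \<le> E"

definition displ_at :: "real \<Rightarrow> 'a \<Rightarrow> real"
  where "displ_at t = displ U (nat \<lfloor>t / step P M\<rfloor>)"

end

end

theory Submission
  imports Defs
begin

text \<open>Part (i) is a pointwise statement in disguise: plate displacements are continuous on the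
  plate, so an essential bound on \<open>\<eta>\<^sup>k\<^sup>+\<^sup>1 - \<eta>\<^sup>k\<close> holds at every point, and the infimum drops by at
  most that bound (\<open>displ_step_lower_bound\<close>).

  Part (ii) rests on a bound \<open>\<bar>\<eta>\<^sup>k\<bar> \<le> H / 2\<close> for all times up to some \<open>T\<^sub>0\<close> that sees the solution only
  through the energy constant \<open>E\<close>; in particular \<open>T\<^sub>0\<close> must not depend on the mesh, the step, the
  material parameters or the size of the plate. Adding up the increments \<open>\<tau> z\<^sup>j\<close> shows that averages
  of \<open>\<eta>\<^sup>k\<close> against a fixed kernel are at most a constant times \<open>t\<^sup>k\<close>. The bound on the Laplacian
  turns averages into values: for a radial kernel \<open>K\<close> supported in the unit ball, the average
  \<open>m(s) = \<integral> \<eta>(x\<^sub>0 + s x) K(x) dx\<close> interpolates between \<open>\<eta>(x\<^sub>0) \<integral> K\<close> at \<open>s = 0\<close> and a true average at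
  \<open>s = R\<close>. As \<open>K\<close> is radial, \<open>K(x) x\<close> is minus the gradient of a potential, so an integration by parts
  expresses \<open>m'(s)\<close> through the Laplacian of \<open>\<eta>\<close> alone. In dimension at most 2 the powers of \<open>s\<close>
  from the scaling cancel well enough for \<open>m'\<close> to be bounded by the energy, uniformly in
  \<open>0 < s \<le> 1\<close> (\<open>abs_le_kernel_average\<close>). Hence \<open>\<bar>\<eta>\<^sup>k(x\<^sub>0)\<bar>\<close> is at most a constant times
  \<open>t\<^sup>k / R\<^sup>n + R\<close> (\<open>abs_displ_le\<close>), and one chooses first \<open>R\<close> and then \<open>T\<^sub>0\<close> small. The averages are
  taken of the extension by zero to the whole space; this keeps the constants independent of the
  plate.

  To make this rigorous for finite element functions, clamped displacements are extended by zero.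
  The extension is \<open>C\<^sup>1\<close> and its gradient is Lipschitz, because it is affine on each of the
  finitely many cells of the plate mesh and vanishes outside the plate (\<open>Wh_zero_ext\<close>). This needs
  the top faces of the volume mesh to cover the plate by cells with nonempty interior
  (\<open>Union_plate_mesh\<close>, \<open>plate_mesh_cell\<close>). Integration by parts for Lipschitz functions is done with
  difference quotients and dominated convergence (\<open>integral_by_parts_Lipschitz\<close>).\<close>
section \<open>Integration by parts for Lipschitz functions\<close>

lemma integral_translation:
  fixes f :: "'b::euclidean_space \<Rightarrow> real"
  assumes [measurable]: "f \<in> borel_measurable borel"
  shows "(\<integral>x. f (x + h) \<partial>lborel) = (\<integral>x. f x \<partial>lborel)"
proof -
  have "(\<integral>x. f x \<partial>lborel) = (\<integral>x. f x \<partial>(distr lborel borel ((+) h)))"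
    by (simp only: lborel_distr_plus)
  also have "\<dots> = (\<integral>x. f (h + x) \<partial>lborel)"
    by (rule integral_distr) auto
  finally show ?thesis by (simp add: add.commute)
qed

lemma integral_scaling:
  fixes f :: "'b::euclidean_space \<Rightarrow> real"
  assumes [measurable]: "f \<in> borel_measurable borel" and "0 < s"
  shows "(\<integral>x. f (x\<^sub>0 + s *\<^sub>R x) \<partial>lborel) = (\<integral>x. f x \<partial>lborel) / s ^ DIM('b)"
proof -
  have "(\<integral>x. f x \<partial>lborel) =
      (\<integral>x. f x \<partial>(density (distr lborel borel (\<lambda>x. x\<^sub>0 + s *\<^sub>R x)) (\<lambda>_. ennreal (s ^ DIM('b)))))"
    using lborel_affine[of s x\<^sub>0] \<open>0 < s\<close> by (simp add: ennreal_power)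
  also have "\<dots> = (\<integral>x. s ^ DIM('b) *\<^sub>R f x \<partial>(distr lborel borel (\<lambda>x. x\<^sub>0 + s *\<^sub>R x)))"
    using \<open>0 < s\<close> by (intro integral_density) auto
  also have "\<dots> = (\<integral>x. s ^ DIM('b) *\<^sub>R f (x\<^sub>0 + s *\<^sub>R x) \<partial>lborel)"
    by (rule integral_distr) auto
  finally show ?thesis using \<open>0 < s\<close> by simp
qed

lemma integrable_continuous_compact_support:
  fixes f :: "'b::euclidean_space \<Rightarrow> real"
  assumes "continuous_on UNIV f" "compact S" "\<And>x. x \<notin> S \<Longrightarrow> f x = 0"
  shows "integrable lborel f"
proof -
  have "integrable lborel (\<lambda>x. indicator S x *\<^sub>R f x)"
    using assms continuous_on_subset by (intro borel_integrable_compact) blast+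
  moreover have "(\<lambda>x. indicator S x *\<^sub>R f x) = f"
    using assms(3) by (auto simp: indicator_def fun_eq_iff)
  ultimately show ?thesis by simp
qed

text \<open>Difference quotients are taken along the sequence of steps \<open>1 / (n + 1)\<close>: measurability and
  dominated convergence are statements about sequences.\<close>

definition diff_quot :: "'b::euclidean_space \<Rightarrow> ('b \<Rightarrow> real) \<Rightarrow> nat \<Rightarrow> 'b \<Rightarrow> real"
  where "diff_quot e f n x = real (Suc n) * (f (x + e /\<^sub>R real (Suc n)) - f x)"

text \<open>The value is arbitrary where the quotients diverge, but for continuous \<open>f\<close> the function is always Borel
  measurable, which the elementwise derivative need not be.\<close>

definition dir_deriv :: "'b::euclidean_space \<Rightarrow> ('b \<Rightarrow> real) \<Rightarrow> 'b \<Rightarrow> real"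
  where "dir_deriv e f x = lim (\<lambda>n. diff_quot e f n x)"

lemma continuous_diff_quot:
  assumes "continuous_on UNIV f" shows "continuous_on UNIV (diff_quot e f n)"
  unfolding diff_quot_def
  by (intro continuous_intros continuous_on_compose2[OF assms]) auto

lemma measurable_dir_deriv [measurable]:
  assumes "continuous_on UNIV f" shows "dir_deriv e f \<in> borel_measurable borel"
  unfolding dir_deriv_def
  by (intro borel_measurable_lim_metric borel_measurable_continuous_onI continuous_diff_quot assms)

lemma diff_quot_tendsto:
  assumes "(f has_derivative f') (at x)"
  shows "(\<lambda>n. diff_quot e f n x) \<longlonglongrightarrow> f' e"
proof -
  interpret f': bounded_linear f' using assms by (rule has_derivative_bounded_linear)
  have "((\<lambda>t. x + t *\<^sub>R e) has_derivative (\<lambda>t. t *\<^sub>R e)) (at (0::real))"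
    by (auto intro!: derivative_eq_intros)
  then have "(f \<circ> (\<lambda>t. x + t *\<^sub>R e) has_derivative f' \<circ> (\<lambda>t. t *\<^sub>R e)) (at (0::real))"
    using assms by (intro diff_chain_at) auto
  then have "((\<lambda>t. f (x + t *\<^sub>R e)) has_field_derivative f' e) (at 0)"
    by (simp add: has_field_derivative_def o_def f'.scaleR mult_commute_abs)
  then have "((\<lambda>t. (f (x + t *\<^sub>R e) - f x) / t) \<longlongrightarrow> f' e) (at 0)"
    by (simp add: DERIV_def)
  moreover have "filterlim (\<lambda>n. 1 / real (Suc n)) (at 0) sequentially"
    using LIMSEQ_Suc[OF lim_1_over_n[where 'a=real]] by (simp add: filterlim_at del: of_nat_Suc)
  ultimately have "(\<lambda>n. (f (x + (1 / real (Suc n)) *\<^sub>R e) - f x) / (1 / real (Suc n))) \<longlonglongrightarrow> f' e"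
    by (rule filterlim_compose)
  then show ?thesis by (simp add: diff_quot_def divide_inverse mult.commute del: of_nat_Suc)
qed

lemma diff_quot_bound:
  assumes "L-lipschitz_on UNIV f"
  shows "\<bar>diff_quot e f n x\<bar> \<le> L * norm e"
proof -
  have "\<bar>f (x + e /\<^sub>R real (Suc n)) - f x\<bar> \<le> L * norm (e /\<^sub>R real (Suc n))"
    using lipschitz_onD[OF assms, of "x + e /\<^sub>R real (Suc n)" x] by (simp add: dist_norm)
  then have "real (Suc n) * \<bar>f (x + e /\<^sub>R real (Suc n)) - f x\<bar> \<le> real (Suc n) * (L * norm (e /\<^sub>R real (Suc n)))"
    by (rule mult_left_mono) simp
  also have "\<dots> = L * norm e" by (simp del: of_nat_Suc)
  finally show ?thesis unfolding diff_quot_def by (simp only: abs_mult abs_of_nat)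
qed

lemma dir_deriv_bound:
  assumes "L-lipschitz_on UNIV f" "convergent (\<lambda>n. diff_quot e f n x)"
  shows "\<bar>dir_deriv e f x\<bar> \<le> L * norm e"
proof -
  have "(\<lambda>n. diff_quot e f n x) \<longlonglongrightarrow> dir_deriv e f x"
    using assms(2) by (simp add: dir_deriv_def convergent_LIMSEQ_iff)
  then show ?thesis
    using diff_quot_bound[OF assms(1)] by (auto intro: LIMSEQ_le_const2 tendsto_rabs)
qed

text \<open>The difference quotient operator is moved from one factor to the other by translation invariance
  of Lebesgue measure, with the direction reversed. The Lipschitz bounds dominate the quotients, so
  that the limit may be taken under both integrals.\<close>

lemma integral_by_parts_Lipschitz:
  fixes f g :: "'b::euclidean_space \<Rightarrow> real"
  assumes f: "L-lipschitz_on UNIV f" "AE x in lborel. convergent (\<lambda>n. diff_quot e f n x)"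
    and g: "M-lipschitz_on UNIV g" "\<And>x. (g has_derivative g' x) (at x)"
    and S: "compact S" "\<And>x. x \<notin> S \<Longrightarrow> f x = 0" "\<And>x. x \<notin> S \<Longrightarrow> g x = 0"
    and g'[measurable]: "(\<lambda>x. g' x e) \<in> borel_measurable borel"
  shows "(\<integral>x. dir_deriv e f x * g x \<partial>lborel) = - (\<integral>x. f x * g' x e \<partial>lborel)"
proof -
  have cf: "continuous_on UNIV f" and cg: "continuous_on UNIV g"
    using f(1) g(1) lipschitz_on_continuous_on by blast+
  note [measurable] = borel_measurable_continuous_onI[OF cf] borel_measurable_continuous_onI[OF cg]
    measurable_dir_deriv[OF cf] borel_measurable_continuous_onI[OF continuous_diff_quot[OF cf]]
    borel_measurable_continuous_onI[OF continuous_diff_quot[OF cg]]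
  have intf: "integrable lborel f" and intg: "integrable lborel g"
    using cf cg S by (auto intro: integrable_continuous_compact_support)
  have dq: "(\<integral>x. diff_quot e f n x * g x \<partial>lborel) = (\<integral>x. f x * diff_quot (- e) g n x \<partial>lborel)" for n
  proof -
    let ?h = "e /\<^sub>R real (Suc n)"
    have 1: "integrable lborel (\<lambda>x. f (x + ?h) * g x)"
      by (rule integrable_continuous_compact_support[OF _ S(1)])
        (auto intro!: continuous_intros continuous_on_compose2[OF cf] cg simp: S)
    have 2: "integrable lborel (\<lambda>x. f x * g (x - ?h))"
      by (rule integrable_continuous_compact_support[OF _ S(1)])
        (auto intro!: continuous_intros continuous_on_compose2[OF cg] cf simp: S)
    have 3: "integrable lborel (\<lambda>x. f x * g x)"
      by (rule integrable_continuous_compact_support[OF _ S(1)])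
        (auto intro!: continuous_intros cg cf simp: S)
    have "(\<integral>x. f (x + ?h) * g (x + ?h - ?h) \<partial>lborel) = (\<integral>x. f x * g (x - ?h) \<partial>lborel)"
      by (rule integral_translation[of "\<lambda>x. f x * g (x - ?h)"]) measurable
    then have "(\<integral>x. f (x + ?h) * g x - f x * g x \<partial>lborel) = (\<integral>x. f x * g (x - ?h) - f x * g x \<partial>lborel)"
      using 1 2 3 by simp
    then have "real (Suc n) * (\<integral>x. f (x + ?h) * g x - f x * g x \<partial>lborel) =
        real (Suc n) * (\<integral>x. f x * g (x - ?h) - f x * g x \<partial>lborel)"
      by (simp only:)
    then show ?thesis
      unfolding diff_quot_def by (simp add: algebra_simps flip: integral_mult_right_zero del: of_nat_Suc)
  qed
  have "(\<lambda>n. \<integral>x. diff_quot e f n x * g x \<partial>lborel) \<longlonglongrightarrow> (\<integral>x. dir_deriv e f x * g x \<partial>lborel)"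
  proof (rule integral_dominated_convergence)
    show "integrable lborel (\<lambda>x. L * norm e * \<bar>g x\<bar>)"
      using intg by auto
    show "AE x in lborel. (\<lambda>n. diff_quot e f n x * g x) \<longlonglongrightarrow> dir_deriv e f x * g x"
      using f(2) by eventually_elim (auto intro!: tendsto_intros simp: dir_deriv_def convergent_LIMSEQ_iff)
    show "AE x in lborel. norm (diff_quot e f n x * g x) \<le> L * norm e * \<bar>g x\<bar>" for n
      using diff_quot_bound[OF f(1)] by (auto simp: abs_mult intro!: mult_right_mono)
  qed auto
  moreover have "(\<lambda>n. \<integral>x. f x * diff_quot (- e) g n x \<partial>lborel) \<longlonglongrightarrow> (\<integral>x. f x * - g' x e \<partial>lborel)"
  proof (rule integral_dominated_convergence)
    show "integrable lborel (\<lambda>x. M * norm e * \<bar>f x\<bar>)"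
      using intf by auto
    show "AE x in lborel. (\<lambda>n. f x * diff_quot (- e) g n x) \<longlonglongrightarrow> f x * - g' x e"
    proof (rule AE_I2)
      fix x
      have "(\<lambda>n. diff_quot (- e) g n x) \<longlonglongrightarrow> g' x (- e)"
        using g(2) by (rule diff_quot_tendsto)
      also have "g' x (- e) = - g' x e"
        using g(2) has_derivative_bounded_linear linear_neg bounded_linear.linear by blast
      finally show "(\<lambda>n. f x * diff_quot (- e) g n x) \<longlonglongrightarrow> f x * - g' x e"
        by (intro tendsto_intros)
    qed
    show "AE x in lborel. norm (f x * diff_quot (- e) g n x) \<le> M * norm e * \<bar>f x\<bar>" for n
      using diff_quot_bound[OF g(1), of "- e"] by (auto simp: abs_mult mult.commute intro!: mult_left_mono)
  qed auto
  ultimately have "(\<integral>x. dir_deriv e f x * g x \<partial>lborel) = (\<integral>x. f x * - g' x e \<partial>lborel)"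
    unfolding dq by (rule LIMSEQ_unique)
  then show ?thesis by simp
qed

section \<open>A radial averaging kernel\<close>

lemma has_real_derivative_pos_part_square:
  "((\<lambda>t. (max 0 t)\<^sup>2) has_real_derivative 2 * max 0 t) (at (t::real))"
proof -
  consider "t > 0" | "t < 0" | "t = 0" by linarith
  then show ?thesis
  proof cases
    case 1
    have "((\<lambda>t. t\<^sup>2) has_real_derivative 2 * max 0 t) (at t)"
      using 1 by (auto intro!: derivative_eq_intros)
    then show ?thesis
      by (rule has_field_derivative_transform_within_open[of _ _ _ "{0<..}"]) (use 1 in auto)
  next
    case 2
    have "((\<lambda>t. 0) has_real_derivative 2 * max 0 t) (at t)"
      using 2 by (auto intro!: derivative_eq_intros)
    then show ?thesis
      by (rule has_field_derivative_transform_within_open[of _ _ _ "{..<0}"]) (use 2 in auto)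
  next
    case 3
    have "((\<lambda>h. (max 0 h)\<^sup>2 / h) \<longlongrightarrow> 0) (at (0::real))"
    proof (rule Lim_null_comparison)
      show "\<forall>\<^sub>F h in at (0::real). norm ((max 0 h)\<^sup>2 / h) \<le> \<bar>h\<bar>"
        by (intro always_eventually) (auto simp: max_def power2_eq_square)
      show "((\<lambda>h. \<bar>h\<bar>) \<longlongrightarrow> 0) (at (0::real))"
        by (intro tendsto_rabs_zero tendsto_ident_at)
    qed
    then show ?thesis using 3 by (simp add: DERIV_def)
  qed
qed

definition bump :: "'b::euclidean_space \<Rightarrow> real"
  where "bump x = max 0 (1 - x \<bullet> x)"

text \<open>The factor is chosen so that \<open>\<nabla>\<close> of this function is \<open>- bump x *\<^sub>R x\<close>. The square makes it
  differentiable across the unit sphere.\<close>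

definition bump_potential :: "'b::euclidean_space \<Rightarrow> real"
  where "bump_potential x = (bump x)\<^sup>2 / 4"

lemma bump_nonneg: "0 \<le> bump x" and bump_le_one: "bump x \<le> 1"
  by (auto simp: bump_def)

lemma bump_eq_zero: "1 \<le> norm x \<Longrightarrow> bump x = 0"
  by (simp add: bump_def dot_square_norm)

lemma continuous_bump [continuous_intros]:
  "continuous_on S f \<Longrightarrow> continuous_on S (\<lambda>x. bump (f x))"
  unfolding bump_def by (intro continuous_intros)

lemma continuous_bump_potential [continuous_intros]:
  "continuous_on S f \<Longrightarrow> continuous_on S (\<lambda>x. bump_potential (f x))"
  unfolding bump_potential_def by (intro continuous_intros) auto

lemma bump_potential_bounds: "0 \<le> bump_potential x" "bump_potential x \<le> bump x"
proof -
  have "(bump x)\<^sup>2 \<le> bump x"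
    using mult_left_mono[OF bump_le_one bump_nonneg, of x] by (simp add: power2_eq_square)
  then show "bump_potential x \<le> bump x"
    using bump_nonneg[of x] by (simp add: bump_potential_def)
qed (simp add: bump_potential_def)

lemma has_derivative_bump_potential:
  "(bump_potential has_derivative (\<lambda>h. - bump x * (x \<bullet> h))) (at x)"
proof -
  have 1: "((\<lambda>x. 1 - x \<bullet> x) has_derivative (\<lambda>h. - (2 * (x \<bullet> h)))) (at x)"
    by (auto intro!: derivative_eq_intros simp: inner_commute)
  have "((\<lambda>t. (max 0 t)\<^sup>2 / 4) has_derivative (\<lambda>h. (1 / 2 * bump x) * h)) (at (1 - x \<bullet> x))"
    by (rule has_derivative_eq_rhs[OF DERIV_cdivide[OF has_real_derivative_pos_part_square,
            unfolded has_field_derivative_def]]) (auto simp: bump_def fun_eq_iff)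
  from diff_chain_at[OF 1 this] show ?thesis
    by (simp add: o_def bump_potential_def[abs_def] bump_def)
qed

lemma integrable_bump: "integrable lborel (bump :: 'b::euclidean_space \<Rightarrow> real)"
  and integrable_bump_square: "integrable lborel (\<lambda>x::'b. (bump x)\<^sup>2)"
  by (rule integrable_continuous_compact_support[of _ "cball 0 1"];
      auto intro!: continuous_intros bump_eq_zero)+

lemma integral_bump_pos: "0 < (\<integral>x. bump (x::'b::euclidean_space) \<partial>lborel)"
proof (rule ccontr)
  assume "\<not> ?thesis"
  then have "(\<integral>x. bump (x::'b) \<partial>lborel) = 0"
    using Bochner_Integration.integral_nonneg[of lborel "bump :: 'b \<Rightarrow> real"] bump_nonneg
    by (metis antisym_conv2)
  then have "AE x in lborel. bump (x::'b) = 0"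
    by (subst (asm) integral_nonneg_eq_0_iff_AE) (auto intro: integrable_bump bump_nonneg)
  then have "AE x in lebesgue. (x::'b) \<in> {x. bump x = 0}"
    by (simp add: AE_completion)
  moreover have "closed {x::'b. bump x = 0}"
    by (intro closed_Collect_eq continuous_intros)
  ultimately have "bump (0::'b) = 0"
    using mem_closed_if_AE_lebesgue by blast
  then show False by (simp add: bump_def)
qed

lemma Lipschitz_scaled_bump_potential:
  fixes x\<^sub>0 :: "'b::euclidean_space"
  assumes "0 < s"
  defines "g' \<equiv> \<lambda>y h. - (bump ((y - x\<^sub>0) /\<^sub>R s) * (((y - x\<^sub>0) /\<^sub>R s) \<bullet> h)) / s"
  shows "((\<lambda>y. bump_potential ((y - x\<^sub>0) /\<^sub>R s)) has_derivative g' y) (at y)"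
    and "(1 / s)-lipschitz_on UNIV (\<lambda>y. bump_potential ((y - x\<^sub>0) /\<^sub>R s))"
proof -
  have 1: "((\<lambda>y. (y - x\<^sub>0) /\<^sub>R s) has_derivative (\<lambda>h. h /\<^sub>R s)) (at y)" for y
    by (auto intro!: derivative_eq_intros)
  show *: "((\<lambda>y. bump_potential ((y - x\<^sub>0) /\<^sub>R s)) has_derivative g' y) (at y)" for y
    using diff_chain_at[OF 1 has_derivative_bump_potential, of y]
    by (simp add: o_def g'_def divide_inverse ac_simps)
  show "(1 / s)-lipschitz_on UNIV (\<lambda>y. bump_potential ((y - x\<^sub>0) /\<^sub>R s))"
  proof (rule bounded_derivative_imp_lipschitz[where f' = g'])
    fix y
    let ?z = "(y - x\<^sub>0) /\<^sub>R s"
    have z: "bump ?z * norm ?z \<le> 1"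
    proof (cases "norm ?z \<le> 1")
      case True
      then show ?thesis
        using mult_mono[OF bump_le_one[of ?z] True] bump_nonneg[of ?z] by simp
    next
      case False
      then show ?thesis using bump_eq_zero[of ?z] by simp
    qed
    show "onorm (g' y) \<le> 1 / s"
    proof (rule onorm_le)
      fix h
      have "\<bar>g' y h\<bar> = bump ?z * \<bar>?z \<bullet> h\<bar> / s"
        using \<open>0 < s\<close> bump_nonneg[of ?z] by (simp add: g'_def abs_mult)
      also have "\<dots> \<le> bump ?z * (norm ?z * norm h) / s"
        using \<open>0 < s\<close> by (intro divide_right_mono mult_left_mono bump_nonneg Cauchy_Schwarz_ineq2) auto
      also have "\<dots> \<le> 1 * norm h / s"
        using \<open>0 < s\<close> z by (simp only: mult.assoc[symmetric], intro divide_right_mono mult_right_mono) auto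
      finally show "norm (g' y h) \<le> 1 / s * norm h" by simp
    qed
  qed (use \<open>0 < s\<close> * in \<open>simp_all add: has_derivative_at_withinI\<close>)
qed

lemma integral_eq_integral_cbox:
  fixes f :: "'b::euclidean_space \<Rightarrow> real"
  assumes "continuous_on UNIV f" "\<And>x. x \<notin> cbox a b \<Longrightarrow> f x = 0"
  shows "(\<integral>x. f x \<partial>lborel) = integral (cbox a b) f"
proof -
  have "integral (cbox a b) f = integral UNIV (\<lambda>x. if x \<in> cbox a b then f x else 0)"
    by (simp add: integral_restrict_UNIV)
  also have "(\<lambda>x. if x \<in> cbox a b then f x else 0) = f"
    using assms(2) by auto
  also have "integral UNIV f = (\<integral>x. f x \<partial>lborel)"
    using assms by (intro integral_lborel integrable_continuous_compact_support[of _ "cbox a b"]) auto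
  finally show ?thesis by simp
qed

lemma one_le_norm_scaled:
  fixes y x\<^sub>0 :: "'b::euclidean_space"
  assumes "y \<notin> cball x\<^sub>0 s" "0 < s"
  shows "1 \<le> norm ((y - x\<^sub>0) /\<^sub>R s)"
proof -
  have "s * norm ((y - x\<^sub>0) /\<^sub>R s) = norm (y - x\<^sub>0)" using \<open>0 < s\<close> by simp
  also have "\<dots> \<ge> s" using assms by (simp add: dist_norm norm_minus_commute)
  finally show ?thesis using \<open>0 < s\<close> by simp
qed

text \<open>Stated for kernels dominated by \<open>bump\<close> because it serves both \<open>bump\<close> itself and its potential.\<close>

lemma integral_scaled_kernel_square_le:
  fixes k :: "'b::euclidean_space \<Rightarrow> real"
  assumes k: "continuous_on UNIV k" "\<And>x. \<bar>k x\<bar> \<le> bump x" and "0 < s"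
  shows "integrable lborel (\<lambda>y. (k ((y - x\<^sub>0) /\<^sub>R s))\<^sup>2)"
    and "(\<integral>y. (k ((y - x\<^sub>0) /\<^sub>R s))\<^sup>2 \<partial>lborel) \<le> s ^ DIM('b) * (\<integral>x. (bump (x::'b))\<^sup>2 \<partial>lborel)"
proof -
  have [measurable]: "k \<in> borel_measurable borel"
    using k(1) by (rule borel_measurable_continuous_onI)
  have k0: "k x = 0" if "1 \<le> norm x" for x
    using k(2)[of x] bump_eq_zero[OF that] by simp
  show "integrable lborel (\<lambda>y. (k ((y - x\<^sub>0) /\<^sub>R s))\<^sup>2)"
  proof (rule integrable_continuous_compact_support[of _ "cball x\<^sub>0 s"])
    show "continuous_on UNIV (\<lambda>y. (k ((y - x\<^sub>0) /\<^sub>R s))\<^sup>2)"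
      by (intro continuous_intros continuous_on_compose2[OF k(1)]) auto
    show "(k ((y - x\<^sub>0) /\<^sub>R s))\<^sup>2 = 0" if "y \<notin> cball x\<^sub>0 s" for y
      using that \<open>0 < s\<close> using k0[OF one_le_norm_scaled[OF that \<open>0 < s\<close>]] by simp
  qed auto
  have "(\<integral>x. (k ((x\<^sub>0 + s *\<^sub>R x - x\<^sub>0) /\<^sub>R s))\<^sup>2 \<partial>lborel) = (\<integral>y. (k ((y - x\<^sub>0) /\<^sub>R s))\<^sup>2 \<partial>lborel) / s ^ DIM('b)"
    using \<open>0 < s\<close> by (intro integral_scaling) measurable
  then have "(\<integral>y. (k ((y - x\<^sub>0) /\<^sub>R s))\<^sup>2 \<partial>lborel) = s ^ DIM('b) * (\<integral>x. (k x)\<^sup>2 \<partial>lborel)"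
    using \<open>0 < s\<close> by simp
  also have "(\<integral>x. (k x)\<^sup>2 \<partial>lborel) \<le> (\<integral>x. (bump (x::'b))\<^sup>2 \<partial>lborel)"
    using k(2) by (intro integral_mono' integrable_bump_square) (auto simp: abs_le_square_iff[symmetric] bump_nonneg)
  finally show "(\<integral>y. (k ((y - x\<^sub>0) /\<^sub>R s))\<^sup>2 \<partial>lborel) \<le> s ^ DIM('b) * (\<integral>x. (bump (x::'b))\<^sup>2 \<partial>lborel)"
    using \<open>0 < s\<close> by simp
qed

text \<open>Young's inequality with a free weight \<open>l\<close>, to be chosen as a power of the length scale so that
  both terms scale alike.\<close>

lemma abs_integral_mult_le:
  fixes f g :: "'b::euclidean_space \<Rightarrow> real"
  assumes f: "integrable lborel (\<lambda>x. (f x)\<^sup>2)" and g: "integrable lborel (\<lambda>x. (g x)\<^sup>2)" and "0 < l"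
  shows "\<bar>\<integral>x. f x * g x \<partial>lborel\<bar> \<le> (l * (\<integral>x. (f x)\<^sup>2 \<partial>lborel) + (\<integral>x. (g x)\<^sup>2 \<partial>lborel) / l) / 2"
proof -
  have pt: "\<bar>f x * g x\<bar> \<le> (l * (f x)\<^sup>2 + (g x)\<^sup>2 / l) / 2" for x
  proof -
    have "0 \<le> (l * \<bar>f x\<bar> - \<bar>g x\<bar>)\<^sup>2 / l" using \<open>0 < l\<close> by simp
    also have "\<dots> = l * (f x)\<^sup>2 + (g x)\<^sup>2 / l - 2 * \<bar>f x * g x\<bar>"
      using \<open>0 < l\<close> by (simp add: power2_eq_square field_simps abs_mult)
    finally show ?thesis by simp
  qed
  have "\<bar>\<integral>x. f x * g x \<partial>lborel\<bar> \<le> (\<integral>x. \<bar>f x * g x\<bar> \<partial>lborel)"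
    by (rule integral_abs_bound)
  also have "\<dots> \<le> (\<integral>x. (l * (f x)\<^sup>2 + (g x)\<^sup>2 / l) / 2 \<partial>lborel)"
    using f g pt by (intro integral_mono') (use \<open>0 < l\<close> in auto)
  also have "\<dots> = (l * (\<integral>x. (f x)\<^sup>2 \<partial>lborel) + (\<integral>x. (g x)\<^sup>2 \<partial>lborel) / l) / 2"
    using f g by simp
  finally show ?thesis .
qed

section \<open>A mean value estimate by the Laplacian\<close>

text \<open>Let \<open>m s\<close> be the average of \<open>\<eta>\<close> over the ball of radius \<open>s\<close> weighted with the kernel. By the mean
  value theorem \<open>m R - m 0 = R * m' s\<close> for some \<open>s\<close> between \<open>0\<close> and \<open>R\<close>. Integrating by parts against
  the potential of the kernel gives \<open>m' s = s * s\<^sup>-\<^sup>n * \<integral> W g\<close>, where \<open>W\<close> is the Laplacian of \<open>\<eta>\<close> and \<open>g\<close>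
  the scaled potential, whose square has integral at most of order \<open>s\<^sup>n\<close>. Young's inequality with
  weight \<open>s\<^sup>n\<^sup>-\<^sup>1\<close> then bounds \<open>m' s\<close> by \<open>A / 2\<close> plus a term of order \<open>s\<^sup>2\<^sup>-\<^sup>n\<close>; this is bounded as
  \<open>s\<close> tends to \<open>0\<close> exactly when \<open>n \<le> 2\<close>.\<close>

lemma abs_le_kernel_average:
  fixes \<eta> :: "'b::euclidean_space \<Rightarrow> real" and G :: "'b \<Rightarrow> 'b"
  defines "W \<equiv> \<lambda>x. \<Sum>i\<in>Basis. dir_deriv i (\<lambda>y. G y \<bullet> i) x"
  assumes dim: "DIM('b) \<le> 2"
    and \<eta>: "\<And>x. (\<eta> has_derivative (\<lambda>h. G x \<bullet> h)) (at x)"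
    and lip: "\<And>i. i \<in> Basis \<Longrightarrow> L-lipschitz_on UNIV (\<lambda>x. G x \<bullet> i)"
    and conv: "\<And>i. i \<in> Basis \<Longrightarrow> AE x in lborel. convergent (\<lambda>n. diff_quot i (\<lambda>y. G y \<bullet> i) n x)"
    and S: "compact S" "\<And>x. x \<notin> S \<Longrightarrow> G x = 0"
    and W: "integrable lborel (\<lambda>x. (W x)\<^sup>2)" "(\<integral>x. (W x)\<^sup>2 \<partial>lborel) \<le> A"
    and R: "0 < R" "R \<le> 1"
  shows "\<bar>\<eta> x\<^sub>0\<bar> * (\<integral>x. bump (x::'b) \<partial>lborel) \<le>
    \<bar>\<integral>y. \<eta> y * bump ((y - x\<^sub>0) /\<^sub>R R) \<partial>lborel\<bar> / R ^ DIM('b)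
      + R * (A + (\<integral>x. (bump (x::'b))\<^sup>2 \<partial>lborel)) / 2"
proof -
  define m where "m s = (\<integral>x. \<eta> (x\<^sub>0 + s *\<^sub>R x) * bump x \<partial>lborel)" for s
  define m' where "m' s = (\<integral>x. (G (x\<^sub>0 + s *\<^sub>R x) \<bullet> x) * bump x \<partial>lborel)" for s
  define v where "v = (\<integral>x. (bump (x::'b))\<^sup>2 \<partial>lborel)"
  have "0 \<le> v" unfolding v_def by simp
  have c\<eta>: "continuous_on UNIV \<eta>"
    using \<eta> by (meson differentiable_imp_continuous_on differentiable_on_def differentiable_at_withinI differentiableI)
  have cGi: "continuous_on UNIV (\<lambda>x. G x \<bullet> i)" if "i \<in> Basis" for i
    using lip[OF that] by (rule lipschitz_on_continuous_on)
  have cG: "continuous_on UNIV G"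
    by (subst continuous_on_componentwise) (use cGi in auto)
  note [measurable] = borel_measurable_continuous_onI[OF c\<eta>] borel_measurable_continuous_onI[OF cG]
    borel_measurable_continuous_onI[OF continuous_bump[OF continuous_on_id]]

  have out: "bump x = 0" if "x \<notin> cbox (-One) One" for x :: 'b
  proof (rule bump_eq_zero)
    have "\<exists>i\<in>Basis. \<not> (- 1 \<le> x \<bullet> i \<and> x \<bullet> i \<le> 1)"
      using that by (auto simp: mem_box)
    then obtain i where i: "i \<in> Basis" "\<not> (- 1 \<le> x \<bullet> i \<and> x \<bullet> i \<le> 1)" by blast
    then show "1 \<le> norm x" using Basis_le_norm[OF i(1), of x] by linarith
  qed
  have m: "(m has_real_derivative m' s) (at s)" for s
  proof -
    let ?Q = "cbox (-One) One :: 'b set"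
    have "((\<lambda>s. integral ?Q (\<lambda>x. \<eta> (x\<^sub>0 + s *\<^sub>R x) * bump x)) has_field_derivative
        integral ?Q (\<lambda>x. (G (x\<^sub>0 + s *\<^sub>R x) \<bullet> x) * bump x)) (at s within UNIV)"
    proof (rule leibniz_rule_field_derivative)
      fix t x
      have "((\<lambda>t. x\<^sub>0 + t *\<^sub>R x) has_derivative (\<lambda>h. h *\<^sub>R x)) (at (t::real))"
        by (auto intro!: derivative_eq_intros)
      from diff_chain_at[OF this \<eta>]
      have "((\<lambda>t. \<eta> (x\<^sub>0 + t *\<^sub>R x)) has_field_derivative G (x\<^sub>0 + t *\<^sub>R x) \<bullet> x) (at t)"
        by (simp add: has_field_derivative_def o_def mult_commute_abs)
      then show "((\<lambda>t. \<eta> (x\<^sub>0 + t *\<^sub>R x) * bump x) has_field_derivative (G (x\<^sub>0 + t *\<^sub>R x) \<bullet> x) * bump x) (at t within UNIV)"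
        by (auto intro!: derivative_eq_intros)
    next
      show "(\<lambda>x. \<eta> (x\<^sub>0 + t *\<^sub>R x) * bump x) integrable_on ?Q" for t
        by (intro integrable_continuous continuous_intros continuous_on_compose2[OF c\<eta>]) auto
      show "continuous_on (UNIV \<times> ?Q) (\<lambda>(t, x). (G (x\<^sub>0 + t *\<^sub>R x) \<bullet> x) * bump x)"
        unfolding case_prod_beta by (intro continuous_intros continuous_on_compose2[OF cG]) auto
    qed auto
    moreover have "(\<lambda>s. integral ?Q (\<lambda>x. \<eta> (x\<^sub>0 + s *\<^sub>R x) * bump x)) = m"
      unfolding m_def using out
      by (intro ext integral_eq_integral_cbox[symmetric])
        (auto intro!: continuous_intros continuous_on_compose2[OF c\<eta>])
    moreover have "integral ?Q (\<lambda>x. (G (x\<^sub>0 + s *\<^sub>R x) \<bullet> x) * bump x) = m' s"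
      unfolding m'_def using out
      by (intro integral_eq_integral_cbox[symmetric])
        (auto intro!: continuous_intros continuous_on_compose2[OF cG])
    ultimately show ?thesis by simp
  qed

  have m'_bound: "\<bar>m' s\<bar> \<le> (A + v) / 2" if s: "0 < s" "s \<le> 1" for s
  proof -
    define g where "g y = bump_potential ((y - x\<^sub>0) /\<^sub>R s)" for y
    define g' where "g' y h = - (bump ((y - x\<^sub>0) /\<^sub>R s) * (((y - x\<^sub>0) /\<^sub>R s) \<bullet> h)) / s" for y h
    have g: "(1 / s)-lipschitz_on UNIV g" "(g has_derivative g' y) (at y)" for y
      using Lipschitz_scaled_bump_potential[OF s(1)] unfolding g_def[abs_def] g'_def[abs_def] by auto
    have cg: "continuous_on UNIV g" using g(1) by (rule lipschitz_on_continuous_on)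
    note [measurable] = borel_measurable_continuous_onI[OF cg]
    have g0: "bump_potential ((y - x\<^sub>0) /\<^sub>R s) = 0" "bump ((y - x\<^sub>0) /\<^sub>R s) = 0" if "y \<notin> cball x\<^sub>0 s" for y
    proof -
      have "1 \<le> norm ((y - x\<^sub>0) /\<^sub>R s)"
        using that s(1) by (rule one_le_norm_scaled)
      then show "bump_potential ((y - x\<^sub>0) /\<^sub>R s) = 0" "bump ((y - x\<^sub>0) /\<^sub>R s) = 0"
        by (auto simp: bump_eq_zero bump_potential_def)
    qed
    have intg: "integrable lborel g"
      using cg g0 by (intro integrable_continuous_compact_support[of _ "cball x\<^sub>0 s"]) (auto simp: g_def)
    have parts: "(\<integral>x. dir_deriv i (\<lambda>y. G y \<bullet> i) x * g x \<partial>lborel) = - (\<integral>x. (G x \<bullet> i) * g' x i \<partial>lborel)"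
      if "i \<in> Basis" for i
    proof (rule integral_by_parts_Lipschitz[OF lip[OF that] conv[OF that] g, of "S \<union> cball x\<^sub>0 s"])
      show "(\<lambda>x. g' x i) \<in> borel_measurable borel" unfolding g'_def by measurable
    qed (use S g0 in \<open>auto simp: g_def\<close>)
    have intW: "integrable lborel (\<lambda>x. dir_deriv i (\<lambda>y. G y \<bullet> i) x * g x)" if i: "i \<in> Basis" for i
    proof (rule Bochner_Integration.integrable_bound)
      show "integrable lborel (\<lambda>x. L * norm i * \<bar>g x\<bar>)" using intg by auto
      show "(\<lambda>x. dir_deriv i (\<lambda>y. G y \<bullet> i) x * g x) \<in> borel_measurable lborel"
        using measurable_dir_deriv[OF cGi[OF i], of i] by measurable
      show "AE x in lborel. norm (dir_deriv i (\<lambda>y. G y \<bullet> i) x * g x) \<le> norm (L * norm i * \<bar>g x\<bar>)"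
        using conv[OF i]
      proof eventually_elim
        case (elim x)
        have "\<bar>dir_deriv i (\<lambda>y. G y \<bullet> i) x\<bar> * \<bar>g x\<bar> \<le> L * norm i * \<bar>g x\<bar>"
          using dir_deriv_bound[OF lip[OF i] elim] by (intro mult_right_mono) auto
        also have "\<dots> \<le> \<bar>L * norm i * \<bar>g x\<bar>\<bar>" by (rule abs_ge_self)
        finally show ?case by (simp add: abs_mult)
      qed
    qed
    have intGg': "integrable lborel (\<lambda>x. (G x \<bullet> i) * g' x i)" if i: "i \<in> Basis" for i
      using s by (intro integrable_continuous_compact_support[OF _ S(1)])
        (auto intro!: continuous_intros cG simp: g'_def S)
    \<comment> \<open>The integrand of \<open>m' s\<close> in the variable \<open>y = x\<^sub>0 + s *\<^sub>R x\<close>.\<close>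
    define F where "F y = (G y \<bullet> ((y - x\<^sub>0) /\<^sub>R s)) * bump ((y - x\<^sub>0) /\<^sub>R s)" for y
    have F: "F y = - s * (\<Sum>i\<in>Basis. (G y \<bullet> i) * g' y i)" for y
    proof -
      have "F y = (\<Sum>i\<in>Basis. (G y \<bullet> i) * (((y - x\<^sub>0) /\<^sub>R s) \<bullet> i)) * bump ((y - x\<^sub>0) /\<^sub>R s)"
        unfolding F_def by (subst euclidean_inner) simp
      also have "\<dots> = - s * (\<Sum>i\<in>Basis. (G y \<bullet> i) * g' y i)"
        using s unfolding g'_def sum_distrib_left sum_distrib_right by (intro sum.cong) auto
      finally show ?thesis .
    qed
    have [measurable]: "F \<in> borel_measurable borel" unfolding F_def by measurable
    have "m' s = (\<integral>x. F (x\<^sub>0 + s *\<^sub>R x) \<partial>lborel)"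
      using s by (simp add: m'_def F_def)
    also have "\<dots> = (\<integral>y. F y \<partial>lborel) / s ^ DIM('b)"
      using s(1) by (intro integral_scaling) auto
    also have "(\<integral>y. F y \<partial>lborel) = - s * (\<Sum>i\<in>Basis. \<integral>y. (G y \<bullet> i) * g' y i \<partial>lborel)"
      unfolding F using intGg' by (simp add: Bochner_Integration.integral_sum)
    also have "\<dots> = s * (\<Sum>i\<in>Basis. \<integral>y. dir_deriv i (\<lambda>y. G y \<bullet> i) y * g y \<partial>lborel)"
      using parts by (simp add: sum_negf)
    also have "\<dots> = s * (\<integral>y. W y * g y \<partial>lborel)"
      unfolding W_def sum_distrib_right using intW by (simp add: Bochner_Integration.integral_sum)
    finally have m': "m' s = s * (\<integral>y. W y * g y \<partial>lborel) / s ^ DIM('b)" .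

    \<comment> \<open>The weight in Young's inequality is \<open>s ^ n\<close> with \<open>n\<close> one less than the dimension.\<close>
    obtain n where n: "DIM('b) = Suc n" "n \<le> 1"
      using dim DIM_positive[where 'a='b] by (cases "DIM('b)") auto
    have k: "continuous_on UNIV (bump_potential :: 'b \<Rightarrow> real)" "\<And>x::'b. \<bar>bump_potential x\<bar> \<le> bump x"
      by (auto intro!: continuous_intros simp: bump_potential_bounds)
    have "\<bar>\<integral>y. W y * g y \<partial>lborel\<bar> \<le> (s ^ n * (\<integral>y. (W y)\<^sup>2 \<partial>lborel) + (\<integral>y. (g y)\<^sup>2 \<partial>lborel) / s ^ n) / 2"
      using s W(1) integral_scaled_kernel_square_le(1)[OF k s(1), of x\<^sub>0]
      by (intro abs_integral_mult_le) (auto simp: g_def)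
    also have "\<dots> \<le> (s ^ n * A + s ^ Suc n * v / s ^ n) / 2"
      using s W(2) integral_scaled_kernel_square_le(2)[OF k s(1), of x\<^sub>0]
      by (intro divide_right_mono add_mono mult_left_mono) (auto simp: g_def v_def n(1)[symmetric])
    also have "s ^ Suc n * v / s ^ n = s * v" using s by simp
    also have "s * v \<le> s ^ n * v"
      using s n(2) \<open>0 \<le> v\<close> power_decreasing[of n 1 s] by (intro mult_right_mono) auto
    finally have "\<bar>\<integral>y. W y * g y \<partial>lborel\<bar> \<le> s ^ n * ((A + v) / 2)"
      by (simp add: algebra_simps)
    then show ?thesis
      using s by (simp add: m' n(1) abs_mult field_simps)
  qed

  obtain s where s: "0 < s" "s < R" "m R - m 0 = (R - 0) * m' s"
    using MVT2[of 0 R m m'] m R(1) by auto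
  have "\<bar>m 0\<bar> = \<bar>\<eta> x\<^sub>0\<bar> * (\<integral>x. bump (x::'b) \<partial>lborel)"
    using integral_bump_pos[where 'b='b] by (simp add: m_def abs_mult)
  moreover have "\<bar>m R\<bar> = \<bar>\<integral>y. \<eta> y * bump ((y - x\<^sub>0) /\<^sub>R R) \<partial>lborel\<bar> / R ^ DIM('b)"
  proof -
    have "(\<integral>x. \<eta> (x\<^sub>0 + R *\<^sub>R x) * bump ((x\<^sub>0 + R *\<^sub>R x - x\<^sub>0) /\<^sub>R R) \<partial>lborel)
        = (\<integral>y. \<eta> y * bump ((y - x\<^sub>0) /\<^sub>R R) \<partial>lborel) / R ^ DIM('b)"
      using R(1) by (intro integral_scaling) measurable
    then have "m R = (\<integral>y. \<eta> y * bump ((y - x\<^sub>0) /\<^sub>R R) \<partial>lborel) / R ^ DIM('b)"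
      using R(1) by (simp add: m_def)
    then show ?thesis using R(1) by simp
  qed
  moreover have "\<bar>m 0\<bar> \<le> \<bar>m R\<bar> + R * \<bar>m' s\<bar>"
  proof -
    have "\<bar>m 0\<bar> = \<bar>m R - R * m' s\<bar>" using s(3) by simp
    also have "\<dots> \<le> \<bar>m R\<bar> + \<bar>R * m' s\<bar>" by (rule abs_triangle_ineq4)
    finally show ?thesis using R(1) by (simp add: abs_mult)
  qed
  moreover have "R * \<bar>m' s\<bar> \<le> R * (A + v) / 2"
    using mult_left_mono[OF m'_bound[of s], of R] s R by simp
  ultimately show ?thesis
    unfolding v_def by linarith
qed

section \<open>The mesh of the plate\<close>

lemma plate_properties:
  assumes "admissible_problem (P :: 'a::euclidean_space problem)"
  shows "compact (plate P)" "convex (plate P)" "interior (plate P) \<noteq> {}" "plate P \<noteq> {}"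
proof -
  have "box 0 (side_lengths P) \<noteq> {}"
    using assms by (auto simp: admissible_problem_def box_ne_empty)
  then show "interior (plate P) \<noteq> {}" by (simp add: plate_def)
  then show "plate P \<noteq> {}" using interior_subset by blast
qed (auto simp: plate_def)

text \<open>A top face lies in a horizontal hyperplane, on which the projection to the plate is injective.
  So the cell has the dimension of a facet of a full-dimensional simplex, which is that of the plate.\<close>

lemma plate_mesh_cell:
  assumes adm: "conforming_mesh (ref_mesh M) (ref_domain (P :: 'a::euclidean_space problem))"
    and S: "S \<in> plate_mesh P M"
  shows "convex S" "compact S" "interior S \<noteq> {}" "S \<subseteq> plate P"
proof -
  obtain F K where F: "S = fst ` F" "F \<subseteq> plate P \<times> {height P}" and K: "K \<in> ref_mesh M" "F facet_of K"
    using S by (auto simp: plate_mesh_def top_faces_def faces_def)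
  have simp: "int DIM('a pt) simplex K"
    using adm K by (auto simp: conforming_mesh_def)
  then have cK: "convex K" "compact K" "aff_dim K = int DIM('a pt)"
    using convex_simplex compact_simplex aff_dim_simplex by blast+
  have FK: "F face_of K" using K(2) by (simp add: facet_of_def)
  have "convex F" "compact F"
    using FK cK by (auto intro: face_of_imp_convex face_of_imp_compact)
  then show "convex S" "compact S"
    unfolding F(1) by (auto intro!: convex_linear_image compact_continuous_image continuous_intros linear_fst)
  have "F = (+) (0, height P) ` (\<lambda>x. (x, 0)) ` S"
    unfolding F(1) using F(2) by (force simp: image_iff)
  then have "aff_dim F = aff_dim ((\<lambda>x. (x, 0::real)) ` S)"
    by (simp only: aff_dim_translation_eq)
  also have "\<dots> = aff_dim S"
    by (rule aff_dim_injective_linear_image) (auto intro!: linearI injI)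
  finally have "aff_dim S = int DIM('a)"
    using K(2) cK(3) by (simp add: facet_of_def)
  then show "interior S \<noteq> {}"
    using \<open>convex S\<close> by (metis aff_dim_empty interior_rel_interior_gen rel_interior_eq_empty
      of_nat_less_0_iff neg_less_0_iff_less zero_less_one of_nat_0_le_iff not_less)
  show "S \<subseteq> plate P" using F by auto
qed

lemma finite_plate_mesh:
  assumes adm: "conforming_mesh (ref_mesh M) (ref_domain (P :: 'a::euclidean_space problem))"
  shows "finite (plate_mesh P M)"
proof -
  have "finite {F. F facet_of K}" if "K \<in> ref_mesh M" for K
  proof -
    have "int DIM('a pt) simplex K" using adm that by (auto simp: conforming_mesh_def)
    then have "finite {F. F face_of K}"
      by (intro finite_polytope_faces simplex_imp_polytope)
    then show ?thesis by (rule rev_finite_subset) (auto simp: facet_of_def)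
  qed
  moreover have "finite (ref_mesh M)"
    using adm by (auto simp: conforming_mesh_def triangulation_def)
  moreover have "faces (ref_mesh M) = (\<Union>K\<in>ref_mesh M. {F. F facet_of K})"
    by (auto simp: faces_def)
  ultimately have "finite (faces (ref_mesh M))" by auto
  then show ?thesis unfolding plate_mesh_def top_faces_def by auto
qed

text \<open>The top plane supports every element, hence meets it in a face. Where the projection of that face
  has interior points, dimension forces it to be a facet, and the projection is a cell. The remaining
  projections are finitely many convex sets without interior, hence null; together with the cells they
  cover the plate. The cells form a closed set, so they omit no point of the plate.\<close>

lemma Union_plate_mesh:
  assumes adm: "conforming_mesh (ref_mesh M) (ref_domain (P :: 'a::euclidean_space problem))"
    and H: "0 < height P" and ne: "interior (plate P) \<noteq> {}"
  shows "\<Union>(plate_mesh P M) = plate P"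
proof (rule antisym)
  show "\<Union>(plate_mesh P M) \<subseteq> plate P"
    using plate_mesh_cell(4)[OF adm] by blast
  define top where "top K = K \<inter> {x. (0, 1) \<bullet> x = height P}" for K :: "'a pt set"
  \<comment> \<open>The elements that touch the top plane in a degenerate way, or not at all.\<close>
  define B where "B = {K \<in> ref_mesh M. interior (fst ` top K) = {}}"
  have cK: "convex K" "aff_dim K = int DIM('a pt)" "K \<subseteq> ref_domain P" if "K \<in> ref_mesh M" for K
  proof -
    have simp: "int DIM('a pt) simplex K" and "K \<subseteq> ref_domain P"
      using that adm by (auto simp: conforming_mesh_def)
    then show "convex K" "aff_dim K = int DIM('a pt)" "K \<subseteq> ref_domain P"
      using convex_simplex[OF simp] aff_dim_simplex[OF simp] by auto
  qed
  have topc: "convex (fst ` top K)" if "K \<in> ref_mesh M" for K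
    unfolding top_def using cK(1)[OF that]
    by (intro convex_linear_image linear_fst convex_Int convex_hyperplane)
  have cell: "fst ` top K \<in> plate_mesh P M" if K: "K \<in> ref_mesh M" "K \<notin> B" for K
  proof -
    have face: "top K face_of K"
      unfolding top_def using cK[OF K(1)]
      by (intro face_of_Int_supporting_hyperplane_le) (auto simp: ref_domain_def)
    have "int DIM('a) = aff_dim (fst ` top K)"
      using K by (auto simp: B_def aff_dim_nonempty_interior)
    also have "\<dots> \<le> aff_dim (top K)"
      by (rule aff_dim_linear_image_le) (rule linear_fst)
    finally have ge: "int DIM('a) \<le> aff_dim (top K)" .
    have "aff_dim (top K) \<le> aff_dim {x :: 'a pt. (0, 1) \<bullet> x = height P}"
      by (rule aff_dim_subset) (auto simp: top_def)
    also have "\<dots> = int DIM('a)"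
      by (subst aff_dim_hyperplane) (auto simp: zero_prod_def)
    finally have dim: "aff_dim (top K) = aff_dim K - 1"
      using ge cK(2)[OF K(1)] by simp
    moreover have "top K \<noteq> {}" using ge aff_dim_empty by force
    ultimately have "top K facet_of K"
      using face by (simp add: facet_of_def)
    moreover have "top K \<subseteq> plate P \<times> {height P}"
      using cK(3)[OF K(1)] by (auto simp: top_def ref_domain_def)
    ultimately show ?thesis
      using K(1) by (auto simp: plate_mesh_def top_faces_def faces_def)
  qed
  have "plate P \<subseteq> \<Union>(plate_mesh P M) \<union> (\<Union>K\<in>B. fst ` top K)"
  proof
    fix r assume "r \<in> plate P"
    then have "(r, height P) \<in> \<Union>(ref_mesh M)"
      using H adm by (auto simp: ref_domain_def conforming_mesh_def)
    then obtain K where K: "K \<in> ref_mesh M" "r \<in> fst ` top K"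
      by (force simp: top_def)
    then show "r \<in> \<Union>(plate_mesh P M) \<union> (\<Union>K\<in>B. fst ` top K)"
      using cell by blast
  qed
  moreover have neg: "negligible (\<Union>K\<in>B. fst ` top K)"
  proof (rule negligible_Union)
    show "finite ((\<lambda>K. fst ` top K) ` B)"
      using adm by (auto simp: B_def conforming_mesh_def triangulation_def)
    show "\<And>T. T \<in> (\<lambda>K. fst ` top K) ` B \<Longrightarrow> negligible T"
      using topc negligible_convex_interior by (auto simp: B_def)
  qed
  moreover have cl: "closed (\<Union>(plate_mesh P M))"
    using finite_plate_mesh[OF adm] plate_mesh_cell(2)[OF adm] by (intro closed_Union) (auto intro: compact_imp_closed)
  ultimately have "negligible (interior (plate P) - \<Union>(plate_mesh P M))"
    using interior_subset by (blast intro: negligible_subset)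
  then have "interior (plate P) - \<Union>(plate_mesh P M) = {}"
    using open_not_negligible[of "interior (plate P) - \<Union>(plate_mesh P M)"] cl by (auto simp: open_Diff)
  then have "closure (interior (plate P)) \<subseteq> \<Union>(plate_mesh P M)"
    using cl by (intro closure_minimal) auto
  then show "plate P \<subseteq> \<Union>(plate_mesh P M)"
    using ne convex_closure_interior[of "plate P"] by (simp add: plate_def)
qed

section \<open>Extension of plate displacements by zero\<close>

text \<open>On a segment this is the corresponding fact for intervals of real numbers.\<close>

lemma lipschitz_on_finite_closed_cover:
  fixes f :: "'b::real_normed_vector \<Rightarrow> 'c::metric_space"
  assumes "finite I" and closed: "\<And>i. i \<in> I \<Longrightarrow> closed (U i)"
    and lip: "\<And>i. i \<in> I \<Longrightarrow> \<exists>M. M-lipschitz_on (U i) f" and cover: "(\<Union>i\<in>I. U i) = UNIV"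
  shows "\<exists>M. M-lipschitz_on UNIV f"
proof -
  obtain M where M: "\<And>i. i \<in> I \<Longrightarrow> (M i)-lipschitz_on (U i) f"
    using lip by metis
  define C where "C = (\<Sum>i\<in>I. M i)"
  have M0: "0 \<le> M i" if "i \<in> I" for i
    using M[OF that] by (rule lipschitz_on_nonneg)
  have C: "C-lipschitz_on (U i) f" if "i \<in> I" for i
    unfolding C_def using M[OF that] by (rule lipschitz_on_le) (use M0 that \<open>finite I\<close> in \<open>auto intro: member_le_sum\<close>)
  have "0 \<le> C" unfolding C_def using M0 by (intro sum_nonneg) auto
  have "dist (f x) (f y) \<le> C * dist x y" for x y
  proof -
    \<comment> \<open>Restrict the cover and the function to the segment from \<open>x\<close> to \<open>y\<close>.\<close>
    define p where "p t = x + t *\<^sub>R (y - x)" for t :: real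
    have p: "(dist x y)-lipschitz_on T p" for T
    proof (rule lipschitz_onI)
      fix s t
      have "p s - p t = (s - t) *\<^sub>R (y - x)" by (simp add: p_def algebra_simps)
      then have "dist (p s) (p t) = dist s t * norm (y - x)" by (simp add: dist_norm)
      then show "dist (p s) (p t) \<le> dist x y * dist s t"
        by (simp add: dist_norm norm_minus_commute mult.commute)
    qed simp
    have "(C * dist x y)-lipschitz_on {0..1} (f \<circ> p)"
    proof (rule lipschitz_on_closed_Union[where I = I and U = "\<lambda>i. p -` U i"])
      fix i assume i: "i \<in> I"
      show "(C * dist x y)-lipschitz_on (p -` U i) (f \<circ> p)"
        by (rule lipschitz_on_compose[OF p]) (rule lipschitz_on_subset[OF C[OF i]], auto)
      show "closed (p -` U i)"
        using closed[OF i] by (rule closed_vimage) (auto simp: p_def intro!: continuous_intros)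
    next
      show "{0..1} \<subseteq> (\<Union>i\<in>I. p -` U i)" using cover by blast
    qed (use \<open>finite I\<close> \<open>0 \<le> C\<close> in auto)
    from lipschitz_onD[OF this, of 0 1] show ?thesis by (simp add: p_def)
  qed
  then show ?thesis using \<open>0 \<le> C\<close> by (auto intro!: exI[of _ C] lipschitz_onI)
qed

definition zero_ext :: "'b set \<Rightarrow> ('b \<Rightarrow> 'v::zero) \<Rightarrow> 'b \<Rightarrow> 'v"
  where "zero_ext D f x = (if x \<in> D then f x else 0)"

lemma continuous_on_zero_ext:
  fixes f :: "'b::euclidean_space \<Rightarrow> 'v::real_normed_vector"
  assumes "closed D" "continuous_on D f" "\<And>x. x \<in> frontier D \<Longrightarrow> f x = 0"
  shows "continuous_on UNIV (zero_ext D f)"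
proof -
  have "continuous_on (D \<union> closure (- D)) (\<lambda>x. if x \<in> D then f x else 0)"
  proof (rule continuous_on_cases)
    show "\<forall>x. x \<in> D \<and> x \<notin> D \<or> x \<in> closure (- D) \<and> x \<in> D \<longrightarrow> f x = 0"
    proof (intro allI impI)
      fix x assume "x \<in> D \<and> x \<notin> D \<or> x \<in> closure (- D) \<and> x \<in> D"
      then have "x \<in> frontier D" using closure_subset[of D] by (metis IntI frontier_closures subsetD)
      then show "f x = 0" by (rule assms(3))
    qed
  qed (use assms(1,2) in auto)
  moreover have "D \<union> closure (- D) = UNIV" using closure_subset[of "- D"] by auto
  ultimately show ?thesis by (simp add: zero_ext_def[abs_def])
qed

text \<open>At a frontier point the derivative relative to the set and the one relative to its complement are
  both zero, so they combine to a derivative in the full neighbourhood.\<close>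

lemma has_derivative_zero_ext:
  fixes f :: "'b::euclidean_space \<Rightarrow> real"
  assumes D: "closed D" and f: "\<And>x. x \<in> D \<Longrightarrow> (f has_derivative (\<lambda>h. G x \<bullet> h)) (at x within D)"
    and zero: "\<And>x. x \<in> frontier D \<Longrightarrow> f x = 0 \<and> G x = 0"
  shows "(zero_ext D f has_derivative (\<lambda>h. zero_ext D G x \<bullet> h)) (at x)"
proof (cases "x \<in> D")
  case False
  have "((\<lambda>_. 0) has_derivative (\<lambda>h. zero_ext D G x \<bullet> h)) (at x)"
    using False by (simp add: zero_ext_def)
  then show ?thesis
    by (rule has_derivative_transform_within_open[of _ _ _ _ "- D"]) (use D False in \<open>auto simp: zero_ext_def\<close>)
next
  case True
  have GxD: "zero_ext D G x = G x" using True by (simp add: zero_ext_def)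
  have 1: "(zero_ext D f has_derivative (\<lambda>h. zero_ext D G x \<bullet> h)) (at x within D)"
    unfolding GxD by (rule has_derivative_transform[OF True _ f[OF True]]) (simp add: zero_ext_def)
  show ?thesis
  proof (cases "x \<in> interior D")
    case True
    then show ?thesis using 1 by (simp only: at_within_interior[OF True])
  next
    case False
    then have x: "x \<in> frontier D" using True D by (simp add: frontier_def)
    have "((\<lambda>_. 0) has_derivative (\<lambda>h. zero_ext D G x \<bullet> h)) (at x within insert x (- D))"
      using zero[OF x] by (simp add: GxD)
    then have "(zero_ext D f has_derivative (\<lambda>h. zero_ext D G x \<bullet> h)) (at x within insert x (- D))"
      by (rule has_derivative_transform[rotated 2]) (use zero[OF x] in \<open>auto simp: zero_ext_def\<close>)
    then have 2: "(zero_ext D f has_derivative (\<lambda>h. zero_ext D G x \<bullet> h)) (at x within - D)"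
      by (rule has_derivative_subset) auto
    have "((\<lambda>y. norm (zero_ext D f y - zero_ext D f x - zero_ext D G x \<bullet> (y - x)) / norm (y - x)) \<longlongrightarrow> 0)
        (at x within (D \<union> - D))"
      unfolding at_within_union
      by (rule filterlim_sup[OF 1[unfolded has_derivative_iff_norm, THEN conjunct2]
            2[unfolded has_derivative_iff_norm, THEN conjunct2]])
    then have "(zero_ext D f has_derivative (\<lambda>h. zero_ext D G x \<bullet> h)) (at x within (D \<union> - D))"
      by (simp only: has_derivative_iff_norm bounded_linear_inner_right simp_thms)
    then show ?thesis by (simp only: Compl_partition)
  qed
qed

text \<open>In the interior of the cell the gradient is computed from the quadratic. The formula extends to
  the whole cell by continuity, because a convex set with interior points is contained in the closure
  of its interior.\<close>

lemma gradient_affine_on_cell: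
  fixes G :: "'a::euclidean_space \<Rightarrow> 'a"
  assumes S: "convex S" "closed S" "interior S \<noteq> {}" "S \<subseteq> D"
    and B: "linear B" "\<And>r. r \<in> S \<Longrightarrow> \<eta> r = r \<bullet> B r + b \<bullet> r + c"
    and G: "continuous_on D G" "\<And>r. r \<in> D \<Longrightarrow> (\<eta> has_derivative (\<lambda>h. G r \<bullet> h)) (at r within D)"
  shows "\<exists>a d. \<forall>r\<in>S. G r \<bullet> i = a \<bullet> r + d"
proof -
  define a where "a = adjoint B i + B i"
  have "G r \<bullet> i = a \<bullet> r + b \<bullet> i" if r: "r \<in> interior S" for r
  proof -
    have rD: "r \<in> interior D" using r interior_mono[OF S(4)] by blast
    then have "(\<eta> has_derivative (\<lambda>h. G r \<bullet> h)) (at r)"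
      using G(2)[of r] interior_subset by (auto simp: at_within_interior[OF rD])
    moreover have "(\<eta> has_derivative (\<lambda>h. r \<bullet> B h + h \<bullet> B r + b \<bullet> h)) (at r)"
    proof (rule has_derivative_transform_within_open)
      have "(B has_derivative B) (at r)"
        using B(1) by (simp add: linear_imp_has_derivative)
      then show "((\<lambda>r. r \<bullet> B r + b \<bullet> r + c) has_derivative (\<lambda>h. r \<bullet> B h + h \<bullet> B r + b \<bullet> h)) (at r)"
        by (auto intro!: derivative_eq_intros)
      show "x \<bullet> B x + b \<bullet> x + c = \<eta> x" if "x \<in> interior S" for x
        using B(2) interior_subset that by (metis subsetD)
    qed (use r in auto)
    ultimately have "(\<lambda>h. G r \<bullet> h) = (\<lambda>h. r \<bullet> B h + h \<bullet> B r + b \<bullet> h)"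
      by (rule has_derivative_unique)
    then have "G r \<bullet> i = r \<bullet> B i + i \<bullet> B r + b \<bullet> i" by (rule fun_cong)
    also have "i \<bullet> B r = adjoint B i \<bullet> r"
      using adjoint_works[OF B(1)] by (simp add: inner_commute)
    finally show ?thesis by (simp add: a_def inner_add_right inner_commute)
  qed
  then have "interior S \<subseteq> {r \<in> S. G r \<bullet> i - a \<bullet> r = b \<bullet> i}"
    using interior_subset by auto
  moreover have "closed {r \<in> S. G r \<bullet> i - a \<bullet> r = b \<bullet> i}"
    using S(2,4) by (intro continuous_closed_preimage_constant continuous_intros continuous_on_subset[OF G(1)])
  ultimately have "closure (interior S) \<subseteq> {r \<in> S. G r \<bullet> i - a \<bullet> r = b \<bullet> i}"
    by (rule closure_minimal)
  then have "S \<subseteq> {r \<in> S. G r \<bullet> i - a \<bullet> r = b \<bullet> i}"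
    using S convex_closure_interior[of S] by simp
  then have "\<forall>r\<in>S. G r \<bullet> i = a \<bullet> r + b \<bullet> i" by (auto simp: algebra_simps)
  then show ?thesis by blast
qed

text \<open>The Lipschitz bound comes from the closed cover of the space by the cells and the complement of
  the interior of the plate. Outside the frontiers, which are null sets by convexity, the gradient is
  locally affine or zero, so that difference quotients converge to the second derivatives that define
  the elementwise Laplacian.\<close>

lemma Wh_zero_ext:
  fixes P :: "'a::euclidean_space problem"
  assumes adm: "conforming_mesh (ref_mesh M) (ref_domain P)" "admissible_problem P"
    and \<eta>: "\<eta> \<in> Wh P M"
  obtains G L where
    "\<And>x. (zero_ext (plate P) \<eta> has_derivative (\<lambda>h. G x \<bullet> h)) (at x)"
    "\<And>i. i \<in> Basis \<Longrightarrow> L-lipschitz_on UNIV (\<lambda>x. G x \<bullet> i)"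
    "\<And>x. x \<notin> plate P \<Longrightarrow> G x = 0"
    "\<And>i. i \<in> Basis \<Longrightarrow> AE x in lborel. convergent (\<lambda>n. diff_quot i (\<lambda>y. G y \<bullet> i) n x)"
    "AE x in lborel. (\<Sum>i\<in>Basis. dir_deriv i (\<lambda>y. G y \<bullet> i) x) = zero_ext (plate P) (laplacian \<eta>) x"
proof -
  let ?D = "plate P" and ?\<S> = "plate_mesh P M"
  note D = plate_properties[OF adm(2)]
  have clD: "closed ?D" using D(1) by (rule compact_imp_closed)
  have H: "0 < height P" using adm(2) by (simp add: admissible_problem_def)
  note cell = plate_mesh_cell[OF adm(1)]
  have clS: "closed S" if "S \<in> ?\<S>" for S using cell(2)[OF that] by (rule compact_imp_closed)
  have cover: "\<Union>?\<S> = ?D" by (rule Union_plate_mesh[OF adm(1) H D(3)])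
  obtain G0 where G0: "continuous_on ?D G0"
    "\<And>r. r \<in> ?D \<Longrightarrow> (\<eta> has_derivative (\<lambda>h. G0 r \<bullet> h)) (at r within ?D)"
    "\<And>r. r \<in> frontier ?D \<Longrightarrow> \<eta> r = 0 \<and> G0 r = 0"
    and quad: "\<And>S. S \<in> ?\<S> \<Longrightarrow> \<exists>B b c. linear B \<and> (\<forall>r\<in>S. \<eta> r = r \<bullet> B r + b \<bullet> r + c)"
    using \<eta> unfolding Wh_def clamped_quadratic_def by blast
  define G where "G = zero_ext ?D G0"
  have G_out: "G x = 0" if "x \<notin> interior ?D" for x
    using that G0(3)[of x] clD by (auto simp: G_def zero_ext_def frontier_def)
  have aff: "\<exists>a d. \<forall>r\<in>S. G r \<bullet> i = a \<bullet> r + d" if S: "S \<in> ?\<S>" for S i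
  proof -
    obtain B b c where "linear B" "\<And>r. r \<in> S \<Longrightarrow> \<eta> r = r \<bullet> B r + b \<bullet> r + c"
      using quad[OF S] by blast
    from gradient_affine_on_cell[OF cell(1)[OF S] clS[OF S] cell(3)[OF S] cell(4)[OF S] this G0(1,2), of i]
    show ?thesis using cell(4)[OF S] by (fastforce simp: G_def zero_ext_def)
  qed
  have lip: "\<exists>K. K-lipschitz_on UNIV (\<lambda>x. G x \<bullet> i)" for i
  proof (rule lipschitz_on_finite_closed_cover[of "insert (- interior ?D) ?\<S>" "\<lambda>S. S"])
    show "finite (insert (- interior ?D) ?\<S>)"
      using finite_plate_mesh[OF adm(1)] by simp
    show "(\<Union>S\<in>insert (- interior ?D) ?\<S>. S) = UNIV"
      using cover interior_subset[of ?D] by auto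
    fix S assume S: "S \<in> insert (- interior ?D) ?\<S>"
    then show "closed S" using clS by (auto simp: closed_Compl)
    show "\<exists>K. K-lipschitz_on S (\<lambda>x. G x \<bullet> i)"
    proof (cases "S \<in> ?\<S>")
      case True
      then obtain a d where a: "\<And>r. r \<in> S \<Longrightarrow> G r \<bullet> i = a \<bullet> r + d" using aff by blast
      have "(norm a)-lipschitz_on S (\<lambda>x. G x \<bullet> i)"
        by (rule lipschitz_onI)
          (auto simp: a dist_norm real_norm_def Cauchy_Schwarz_ineq2 simp flip: inner_diff_right)
      then show ?thesis by blast
    next
      case False
      then have "0-lipschitz_on S (\<lambda>x. G x \<bullet> i)"
        using S G_out by (auto intro!: lipschitz_onI)
      then show ?thesis by blast
    qed
  qed
  then obtain K where K: "\<And>i. (K i)-lipschitz_on UNIV (\<lambda>x. G x \<bullet> i)" by metis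
  have K0: "0 \<le> K i" for i using K by (rule lipschitz_on_nonneg)

  define N where "N = frontier ?D \<union> (\<Union>S\<in>?\<S>. frontier S)"
  have "negligible N"
    unfolding N_def using finite_plate_mesh[OF adm(1)] cell(1) D(2)
    by (intro negligible_Un negligible_Union) (auto intro: negligible_convex_frontier)
  then have AE_N: "AE x in lborel. x \<notin> N"
    using AE_not_in[of N lebesgue] by (simp add: negligible_iff_null_sets AE_completion_iff)

  have deriv: "(\<eta> has_derivative (\<lambda>h. G y \<bullet> h)) (at y)" if "y \<in> interior ?D" for y
    using that G0(2)[of y] interior_subset[of ?D] by (auto simp: at_within_interior[OF that] G_def zero_ext_def)
  have pd: "pd i \<eta> y = G y \<bullet> i" if "y \<in> interior ?D" for y i
    unfolding pd_def using frechet_derivative_at[OF deriv[OF that]] by metis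
  have key: "\<exists>d. (\<lambda>n. diff_quot i (\<lambda>y. G y \<bullet> i) n x) \<longlonglongrightarrow> d \<and>
      d = zero_ext ?D (pd i (pd i \<eta>)) x" if x: "x \<notin> N" for x i
  proof (cases "x \<in> ?D")
    case True
    then obtain S where S: "S \<in> ?\<S>" "x \<in> S" using cover by blast
    have xD: "x \<in> interior ?D" and xS: "x \<in> interior S"
      using x True S clS[OF S(1)] clD by (auto simp: N_def frontier_def)
    obtain a d where a: "\<And>r. r \<in> S \<Longrightarrow> G r \<bullet> i = a \<bullet> r + d" using aff[OF S(1)] by blast
    have "((\<lambda>y. a \<bullet> y + d) has_derivative (\<lambda>h. a \<bullet> h)) (at x)"
      by (auto intro!: derivative_eq_intros)
    then have *: "((\<lambda>y. G y \<bullet> i) has_derivative (\<lambda>h. a \<bullet> h)) (at x)"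
      by (rule has_derivative_transform_within_open[of _ _ _ _ "interior S"])
        (use xS a interior_subset[of S] in auto)
    then have "(pd i \<eta> has_derivative (\<lambda>h. a \<bullet> h)) (at x)"
      by (rule has_derivative_transform_within_open[of _ _ _ _ "interior ?D"])
        (use xD pd in auto)
    then have "pd i (pd i \<eta>) x = a \<bullet> i"
      unfolding pd_def[of i "pd i \<eta>"] using frechet_derivative_at by metis
    then show ?thesis
      using diff_quot_tendsto[OF *, of i] True by (auto simp: zero_ext_def)
  next
    case False
    have "((\<lambda>y. 0) has_derivative (\<lambda>h. 0)) (at x)" by simp
    then have "((\<lambda>y. G y \<bullet> i) has_derivative (\<lambda>h. 0)) (at x)"
      by (rule has_derivative_transform_within_open[of _ _ _ _ "- ?D"])
        (use False clD in \<open>auto simp: G_def zero_ext_def\<close>)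
    then show ?thesis
      using diff_quot_tendsto[of "\<lambda>y. G y \<bullet> i" "\<lambda>h. 0" x i] False by (auto simp: zero_ext_def)
  qed
  show ?thesis
  proof
    show "(zero_ext ?D \<eta> has_derivative (\<lambda>h. G x \<bullet> h)) (at x)" for x
      unfolding G_def by (rule has_derivative_zero_ext[OF clD G0(2,3)])
    show "(\<Sum>i\<in>Basis. K i)-lipschitz_on UNIV (\<lambda>x. G x \<bullet> i)" if "i \<in> Basis" for i
      by (rule lipschitz_on_le[OF K]) (auto intro!: member_le_sum that K0)
    show "G x = 0" if "x \<notin> ?D" for x using that by (simp add: G_def zero_ext_def)
    show "AE x in lborel. convergent (\<lambda>n. diff_quot i (\<lambda>y. G y \<bullet> i) n x)" for i
      using AE_N by eventually_elim (use key in \<open>auto simp: convergent_def\<close>)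
    show "AE x in lborel. (\<Sum>i\<in>Basis. dir_deriv i (\<lambda>y. G y \<bullet> i) x) = zero_ext ?D (laplacian \<eta>) x"
      using AE_N
    proof eventually_elim
      case (elim x)
      have "dir_deriv i (\<lambda>y. G y \<bullet> i) x = zero_ext ?D (pd i (pd i \<eta>)) x" for i
        unfolding dir_deriv_def using key[OF elim, of i] by (auto intro: limI)
      then show ?case by (simp add: zero_ext_def laplacian_def)
    qed
  qed
qed

section \<open>Norms and pointwise values\<close>

lemma borel_measurable_lebesgue_AE:
  fixes f g :: "'b::euclidean_space \<Rightarrow> real"
  assumes f: "f \<in> borel_measurable lborel" and AE: "AE x in lborel. f x = g x"
  shows "g \<in> borel_measurable lebesgue"
proof (rule measurableI)
  obtain N where N: "N \<in> null_sets lborel" "{x. f x \<noteq> g x} \<subseteq> N"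
    using AE by (auto elim!: AE_E simp: null_sets_def)
  fix A :: "real set" assume A: "A \<in> sets borel"
  have "g -` A = (f -` A - N) \<union> (g -` A \<inter> N)"
  proof (intro set_eqI)
    fix x
    have "f x = g x" if "x \<notin> N" using N(2) that by blast
    then show "x \<in> g -` A \<longleftrightarrow> x \<in> (f -` A - N) \<union> (g -` A \<inter> N)"
      by (cases "x \<in> N") auto
  qed
  moreover have "f -` A - N \<in> sets lebesgue"
    using measurable_sets[OF f A] N(1) by auto
  moreover have "g -` A \<inter> N \<in> sets lebesgue"
    using null_sets_completion_subset[of "g -` A \<inter> N" N lborel] null_sets_completionI[OF N(1)] by auto
  ultimately have "g -` A \<in> sets lebesgue" by (metis sets.Un)
  then show "g -` A \<inter> space lebesgue \<in> sets lebesgue" by simp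
qed auto

text \<open>Passes from a possibly non-Borel elementwise quantity to a Borel representative, for which
  integrals over the Lebesgue measure and over its Borel restriction agree.\<close>

lemma integral_square_le_Lp_norm:
  fixes v :: "'b::euclidean_space \<Rightarrow> real"
  assumes w: "w \<in> borel_measurable borel" and AE: "AE x in lborel. w x = zero_ext A v x"
    and E: "Lp_norm 2 A v \<le> E"
  shows "(\<integral>x. (w x)\<^sup>2 \<partial>lborel) \<le> E\<^sup>2"
proof -
  define I where "I = (LINT x:A|lebesgue. norm (v x) powr 2)"
  have AE2: "AE x in lborel. (w x)\<^sup>2 = indicator A x *\<^sub>R (norm (v x) powr 2)"
    using AE by eventually_elim (auto simp: zero_ext_def indicator_def)
  have w2: "(\<lambda>x. (w x)\<^sup>2) \<in> borel_measurable lborel" using w by measurable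
  have "(\<integral>x. (w x)\<^sup>2 \<partial>lborel) = (\<integral>x. (w x)\<^sup>2 \<partial>lebesgue)"
    using integral_completion[OF w2] by simp
  also have "\<dots> = (\<integral>x. indicator A x *\<^sub>R (norm (v x) powr 2) \<partial>lebesgue)"
    using AE2 borel_measurable_lebesgue_AE[OF w2 AE2] measurable_completion[OF w2]
    by (intro integral_cong_AE) (auto simp: AE_completion)
  also have "\<dots> = I" by (simp add: I_def set_lebesgue_integral_def)
  finally have I: "(\<integral>x. (w x)\<^sup>2 \<partial>lborel) = I" .
  have "0 \<le> I" by (simp flip: I)
  have "Lp_norm 2 A v = sqrt I"
    using \<open>0 \<le> I\<close> by (simp add: Lp_norm_def I_def powr_half_sqrt)
  then have "I \<le> E\<^sup>2"
    using power_mono[of "sqrt I" E 2] E \<open>0 \<le> I\<close> by simp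
  then show ?thesis by (simp add: I)
qed

text \<open>The set where the bound holds is closed and has full measure, hence contains the interior of the
  domain, and therefore the domain.\<close>

lemma continuous_le_of_Linf_norm:
  fixes v :: "'b::euclidean_space \<Rightarrow> real"
  assumes cont: "continuous_on D v" and D: "convex D" "closed D" "interior D \<noteq> {}"
    and le: "Linf_norm D v \<le> ereal c" and x: "x \<in> D"
  shows "\<bar>v x\<bar> \<le> c"
proof -
  have "AE x in restrict_space lebesgue D. ereal \<bar>v x\<bar> \<le> Linf_norm D v"
    unfolding Linf_norm_def by (rule esssup_AE)
  then have "AE x in restrict_space lebesgue D. \<bar>v x\<bar> \<le> c"
  proof eventually_elim
    case (elim x)
    from order_trans[OF elim le] show ?case by simp
  qed
  moreover have "D \<in> sets lebesgue" using D(2) by auto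
  ultimately have "AE x in lebesgue. x \<in> D \<longrightarrow> \<bar>v x\<bar> \<le> c"
    by (simp add: AE_restrict_space_iff)
  then have ae: "AE x \<in> interior D in lebesgue. x \<in> {x \<in> D. \<bar>v x\<bar> \<le> c}"
    by eventually_elim (use interior_subset[of D] in auto)
  have cl: "closed {x \<in> D. \<bar>v x\<bar> \<le> c}"
  proof -
    have "closed (D \<inter> (\<lambda>x. \<bar>v x\<bar>) -` {..c})"
      using cont D(2) by (intro continuous_closed_preimage continuous_intros) auto
    also have "D \<inter> (\<lambda>x. \<bar>v x\<bar>) -` {..c} = {x \<in> D. \<bar>v x\<bar> \<le> c}" by auto
    finally show ?thesis .
  qed
  have "interior D \<subseteq> {x \<in> D. \<bar>v x\<bar> \<le> c}"
    using mem_closed_if_AE_lebesgue_open[OF open_interior cl ae] by blast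
  then have "closure (interior D) \<subseteq> {x \<in> D. \<bar>v x\<bar> \<le> c}"
    using cl by (rule closure_minimal)
  then show ?thesis
    using x D convex_closure_interior[of D] closure_subset by auto
qed

section \<open>Displacements of discrete solutions\<close>

lemma solves_schemeD:
  assumes "solves_scheme P M U"
  shows "admissible_problem P" "conforming_mesh (ref_mesh M) (ref_domain P)"
    "k \<le> num_steps M \<Longrightarrow> displ U k \<in> Wh P M" "r \<in> plate P \<Longrightarrow> displ U 0 r = 0"
    "0 < step P M" "real (num_steps M) * step P M = final_time P"
proof -
  from assms have P: "admissible_problem P" and M: "admissible_discretisation P M"
    and W: "\<forall>k\<le>num_steps M. displ U k \<in> Wh P M" and init: "initial_conditions P M U"
    unfolding solves_scheme_def by blast+
  show "admissible_problem P" by (rule P)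
  show "conforming_mesh (ref_mesh M) (ref_domain P)"
    using M unfolding admissible_discretisation_def by blast
  have "0 < num_steps M" using M unfolding admissible_discretisation_def by blast
  then show "0 < step P M" "real (num_steps M) * step P M = final_time P"
    using P by (simp_all add: step_def admissible_problem_def)
  show "displ U k \<in> Wh P M" if "k \<le> num_steps M" using W that by blast
  show "displ U 0 r = 0" if "r \<in> plate P" using init that unfolding initial_conditions_def by blast
qed

lemma continuous_on_displ:
  assumes "solves_scheme P M U" "k \<le> num_steps M"
  shows "continuous_on (plate P) (displ U k)"
    and "continuous_on UNIV (zero_ext (plate P) (displ U k))"
proof -
  obtain G where G: "\<And>r. r \<in> plate P \<Longrightarrow> (displ U k has_derivative (\<lambda>h. G r \<bullet> h)) (at r within plate P)"
    and zero: "\<And>r. r \<in> frontier (plate P) \<Longrightarrow> displ U k r = 0"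
    using solves_schemeD(3)[OF assms] unfolding Wh_def clamped_quadratic_def by blast
  show *: "continuous_on (plate P) (displ U k)"
    unfolding continuous_on_eq_continuous_within using G has_derivative_continuous by blast
  have "closed (plate P)" by (simp add: plate_def closed_cbox)
  then show "continuous_on UNIV (zero_ext (plate P) (displ U k))"
    using * zero by (rule continuous_on_zero_ext)
qed

text \<open>The kernel average of \<open>\<eta>\<^sup>k\<close> is the sum of \<open>\<tau>\<close> times the averages of the velocities \<open>z\<^sup>j\<close>, each
  bounded by the energy through Young's inequality. The mean value estimate adds the contribution of
  the Laplacian.\<close>

lemma abs_displ_le:
  fixes P :: "'a::euclidean_space problem"
  defines "\<kappa> \<equiv> \<integral>x. bump (x::'a) \<partial>lborel" and "v \<equiv> \<integral>x. (bump (x::'a))\<^sup>2 \<partial>lborel"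
  assumes dim: "DIM('a) \<le> 2" and sol: "solves_scheme P M U" and en: "energy_bounds P M U E"
    and k: "k \<le> num_steps M" and r: "r \<in> plate P" and R: "0 < R" "R \<le> 1"
  shows "\<bar>displ U k r\<bar> * \<kappa> \<le> (real k * step P M / R ^ DIM('a) + R) * ((E\<^sup>2 + v) / 2)"
proof -
  let ?D = "plate P" and ?\<tau> = "step P M"
  note sol' = solves_schemeD[OF sol]
  note cont = continuous_on_displ(2)[OF sol]
  have compD: "compact ?D" by (rule plate_properties(1)[OF sol'(1)])
  define b where "b y = bump ((y - r) /\<^sub>R R)" for y
  have cb: "continuous_on UNIV b" unfolding b_def by (intro continuous_intros)
  have kern: "continuous_on UNIV (bump :: 'a \<Rightarrow> real)" "\<And>x::'a. \<bar>bump x\<bar> \<le> bump x"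
    by (auto intro!: continuous_intros simp: bump_nonneg)
  have v0: "0 \<le> v" unfolding v_def by simp
  have b2: "integrable lborel (\<lambda>y. (b y)\<^sup>2)" "(\<integral>y. (b y)\<^sup>2 \<partial>lborel) \<le> v"
  proof -
    show "integrable lborel (\<lambda>y. (b y)\<^sup>2)"
      unfolding b_def by (rule integral_scaled_kernel_square_le(1)[OF kern R(1)])
    have "(\<integral>y. (b y)\<^sup>2 \<partial>lborel) \<le> R ^ DIM('a) * v"
      unfolding b_def v_def by (rule integral_scaled_kernel_square_le(2)[OF kern R(1)])
    also have "\<dots> \<le> 1 * v" using R v0 by (intro mult_right_mono power_le_one) auto
    finally show "(\<integral>y. (b y)\<^sup>2 \<partial>lborel) \<le> v" by simp
  qed
  define m where "m j = (\<integral>y. zero_ext ?D (displ U j) y * b y \<partial>lborel)" for j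

  have "\<bar>m j\<bar> \<le> real j * ?\<tau> * ((E\<^sup>2 + v) / 2)" if "j \<le> num_steps M" for j
    using that
  proof (induction j)
    case 0
    have "zero_ext ?D (displ U 0) = (\<lambda>_. 0)" using sol'(4) by (auto simp: zero_ext_def)
    then show ?case by (simp add: m_def)
  next
    case (Suc j)
    define z where "z = zero_ext ?D (plate_vel P M U (Suc j))"
    have z: "z y = (zero_ext ?D (displ U (Suc j)) y - zero_ext ?D (displ U j) y) / ?\<tau>" for y
      by (simp add: z_def zero_ext_def plate_vel_def)
    have cz: "continuous_on UNIV z"
      unfolding z using sol'(5) Suc.prems by (intro continuous_intros cont) auto
    have z0: "z y = 0" if "y \<notin> ?D" for y using that by (simp add: z_def zero_ext_def)
    have "\<bar>\<integral>y. z y * b y \<partial>lborel\<bar> \<le> (1 * (\<integral>y. (z y)\<^sup>2 \<partial>lborel) + (\<integral>y. (b y)\<^sup>2 \<partial>lborel) / 1) / 2"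
    proof (rule abs_integral_mult_le[OF _ b2(1)])
      show "integrable lborel (\<lambda>y. (z y)\<^sup>2)"
        using z0 by (intro integrable_continuous_compact_support[OF _ compD]) (auto intro!: continuous_intros cz)
    qed simp
    moreover have "(\<integral>y. (z y)\<^sup>2 \<partial>lborel) \<le> E\<^sup>2"
    proof (rule integral_square_le_Lp_norm)
      show "z \<in> borel_measurable borel" using cz by (rule borel_measurable_continuous_onI)
      show "Lp_norm 2 ?D (plate_vel P M U (Suc j)) \<le> E"
        using en Suc.prems by (auto simp: energy_bounds_def)
    qed (simp add: z_def)
    ultimately have zb: "\<bar>\<integral>y. z y * b y \<partial>lborel\<bar> \<le> (E\<^sup>2 + v) / 2"
      using b2(2) by simp
    have "m (Suc j) = (\<integral>y. zero_ext ?D (displ U j) y * b y + ?\<tau> * (z y * b y) \<partial>lborel)"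
      unfolding m_def using sol'(5) by (intro Bochner_Integration.integral_cong) (auto simp: z field_simps)
    also have "\<dots> = m j + ?\<tau> * (\<integral>y. z y * b y \<partial>lborel)"
    proof -
      have out: "zero_ext ?D (displ U j) y = 0" if "y \<notin> ?D" for y
        using that by (simp add: zero_ext_def)
      have "integrable lborel (\<lambda>y. zero_ext ?D (displ U j) y * b y)"
        using Suc.prems by (intro integrable_continuous_compact_support[OF _ compD])
          (auto intro!: continuous_intros cont cb simp: out)
      moreover have "integrable lborel (\<lambda>y. z y * b y)"
        using z0 by (intro integrable_continuous_compact_support[OF _ compD]) (auto intro!: continuous_intros cz cb)
      ultimately show ?thesis by (simp add: m_def)
    qed
    finally have "\<bar>m (Suc j)\<bar> \<le> \<bar>m j\<bar> + \<bar>?\<tau> * (\<integral>y. z y * b y \<partial>lborel)\<bar>" by simp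
    also have "\<dots> \<le> real j * ?\<tau> * ((E\<^sup>2 + v) / 2) + ?\<tau> * ((E\<^sup>2 + v) / 2)"
      using Suc zb sol'(5) by (auto simp: abs_mult intro!: add_mono mult_left_mono)
    finally show ?case by (simp add: field_simps)
  qed
  from this[OF k] have mk: "\<bar>m k\<bar> \<le> real k * ?\<tau> * ((E\<^sup>2 + v) / 2)" .

  obtain G L where G: "\<And>x. (zero_ext ?D (displ U k) has_derivative (\<lambda>h. G x \<bullet> h)) (at x)"
    "\<And>i. i \<in> Basis \<Longrightarrow> L-lipschitz_on UNIV (\<lambda>x. G x \<bullet> i)" "\<And>x. x \<notin> ?D \<Longrightarrow> G x = 0"
    "\<And>i. i \<in> Basis \<Longrightarrow> AE x in lborel. convergent (\<lambda>n. diff_quot i (\<lambda>y. G y \<bullet> i) n x)"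
    "AE x in lborel. (\<Sum>i\<in>Basis. dir_deriv i (\<lambda>y. G y \<bullet> i) x) = zero_ext ?D (laplacian (displ U k)) x"
    using Wh_zero_ext[OF sol'(2,1) sol'(3)[OF k]] by blast
  define W where "W x = (\<Sum>i\<in>Basis. dir_deriv i (\<lambda>y. G y \<bullet> i) x)" for x
  have W_meas [measurable]: "W \<in> borel_measurable borel"
    unfolding W_def
    by (intro borel_measurable_sum measurable_dir_deriv lipschitz_on_continuous_on[OF G(2)])
  have "AE x in lborel. \<forall>i\<in>Basis. convergent (\<lambda>n. diff_quot i (\<lambda>y. G y \<bullet> i) n x)"
    using G(4) by (intro AE_finite_allI) auto
  then have W_bound: "AE x in lborel. \<bar>W x\<bar> \<le> real DIM('a) * L"
  proof eventually_elim
    case (elim x)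
    have "\<bar>W x\<bar> \<le> (\<Sum>i\<in>(Basis::'a set). L)"
      unfolding W_def
    proof (rule sum_abs[THEN order_trans], rule sum_mono)
      fix i :: 'a assume i: "i \<in> Basis"
      show "\<bar>dir_deriv i (\<lambda>y. G y \<bullet> i) x\<bar> \<le> L"
        using dir_deriv_bound[OF G(2)[OF i], of i x] elim i by simp
    qed
    then show ?case by simp
  qed
  have "integrable lborel (\<lambda>x. (real DIM('a) * L)\<^sup>2 * indicator ?D x)"
    unfolding plate_def
    by (intro Bochner_Integration.integrable_mult_right integrable_real_indicator emeasure_lborel_cbox_finite) simp
  then have W_int: "integrable lborel (\<lambda>x. (W x)\<^sup>2)"
  proof (rule Bochner_Integration.integrable_bound)
    show "AE x in lborel. norm ((W x)\<^sup>2) \<le> norm ((real DIM('a) * L)\<^sup>2 * indicator ?D x)"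
      using W_bound G(5)
    proof eventually_elim
      case (elim x)
      show ?case
      proof (cases "x \<in> ?D")
        case True
        have "\<bar>W x\<bar>\<^sup>2 \<le> (real DIM('a) * L)\<^sup>2" using elim(1) by (intro power_mono) auto
        then show ?thesis using True by simp
      next
        case False
        then show ?thesis using elim(2) by (simp add: W_def zero_ext_def)
      qed
    qed
  qed simp
  have W_E: "(\<integral>x. (W x)\<^sup>2 \<partial>lborel) \<le> E\<^sup>2"
  proof (rule integral_square_le_Lp_norm[OF W_meas])
    show "AE x in lborel. W x = zero_ext ?D (laplacian (displ U k)) x"
      using G(5) by (simp add: W_def)
    show "Lp_norm 2 ?D (laplacian (displ U k)) \<le> E"
      using en k by (auto simp: energy_bounds_def)
  qed
  have "\<bar>zero_ext ?D (displ U k) r\<bar> * \<kappa> \<le> \<bar>m k\<bar> / R ^ DIM('a) + R * (E\<^sup>2 + v) / 2"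
    unfolding \<kappa>_def v_def m_def b_def
    by (rule abs_le_kernel_average[OF dim G(1,2) G(4) compD G(3) W_int[unfolded W_def] W_E[unfolded W_def] R])
  also have "\<dots> \<le> (real k * ?\<tau> * ((E\<^sup>2 + v) / 2)) / R ^ DIM('a) + R * (E\<^sup>2 + v) / 2"
    using mk R by (intro add_right_mono divide_right_mono) auto
  finally show ?thesis using r by (simp add: zero_ext_def algebra_simps add_divide_distrib)
qed

lemma displ_step_lower_bound:
  fixes P :: "'a::euclidean_space problem"
  assumes sol: "solves_scheme P M U" and k: "k < num_steps M"
    and step: "Linf_norm (plate P) (\<lambda>r. displ U (Suc k) r - displ U k r) \<le> ereal c"
    and low: "a \<le> (INF r\<in>plate P. displ U k r)"
  shows "a - c \<le> (INF r\<in>plate P. displ U (Suc k) r)"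
proof (rule cINF_greatest)
  note sol' = solves_schemeD[OF sol] and D = plate_properties[OF solves_schemeD(1)[OF sol]]
  show "plate P \<noteq> {}" by (rule D(4))
  have cont: "continuous_on (plate P) (displ U k)" "continuous_on (plate P) (displ U (Suc k))"
    using k by (auto intro: continuous_on_displ(1)[OF sol])
  fix r assume r: "r \<in> plate P"
  have "\<bar>displ U (Suc k) r - displ U k r\<bar> \<le> c"
    using continuous_le_of_Linf_norm[OF _ D(2) compact_imp_closed[OF D(1)] D(3) step r] cont
    by (auto intro!: continuous_intros)
  moreover have "bdd_below (displ U k ` plate P)"
    using compact_continuous_image[OF cont(1) D(1)] by (intro bounded_imp_bdd_below compact_imp_bounded)
  then have "(INF r\<in>plate P. displ U k r) \<le> displ U k r"
    using r by (rule cINF_lower)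
  ultimately show "a - c \<le> displ U (Suc k) r" using low by linarith
qed

text \<open>With \<open>B\<close> the energy factor, the bound on \<open>\<bar>\<eta>\<^sup>k\<bar> * \<kappa>\<close> reads \<open>(t / R\<^sup>n + R) * B\<close>. The choice
  \<open>T\<^sub>0 = R\<^sup>n\<^sup>+\<^sup>1\<close> balances the two terms, and \<open>R\<close> is then determined by \<open>2 * R * B \<le> \<kappa> * H / 2\<close>.\<close>

lemma uniform_no_contact_time:
  fixes H E :: real
  assumes dim: "DIM('a::euclidean_space) \<le> 2" and "0 < H"
  shows "\<exists>T\<^sub>0>0. \<forall>(P :: 'a problem) M U t r. solves_scheme P M U \<longrightarrow> energy_bounds P M U E \<longrightarrow>
    0 \<le> t \<longrightarrow> t \<le> T\<^sub>0 \<longrightarrow> t \<le> final_time P \<longrightarrow> r \<in> plate P \<longrightarrow> \<bar>displ_at P M U t r\<bar> \<le> H / 2"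
proof -
  define \<kappa> v where "\<kappa> = (\<integral>x. bump (x::'a) \<partial>lborel)" and "v = (\<integral>x. (bump (x::'a))\<^sup>2 \<partial>lborel)"
  define B where "B = (E\<^sup>2 + v) / 2"
  have "0 < \<kappa>" unfolding \<kappa>_def by (rule integral_bump_pos)
  have "0 \<le> v" unfolding v_def by simp
  then have "0 \<le> B" by (simp add: B_def)
  \<comment> \<open>The \<open>+ 1\<close> guards against \<open>B = 0\<close>.\<close>
  define R where "R = min 1 (\<kappa> * H / (4 * (B + 1)))"
  have R: "0 < R" "R \<le> 1"
    using \<open>0 < \<kappa>\<close> \<open>0 < H\<close> \<open>0 \<le> B\<close> by (auto simp: R_def)
  have "R \<le> \<kappa> * H / (4 * (B + 1))" by (simp add: R_def)
  then have "R * (4 * (B + 1)) \<le> \<kappa> * H"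
    using \<open>0 \<le> B\<close> by (subst (asm) pos_le_divide_eq) auto
  then have RB: "2 * R * B \<le> \<kappa> * (H / 2)"
    using R(1) by (simp add: algebra_simps)
  show ?thesis
  proof (intro exI[of _ "R ^ Suc DIM('a)"] conjI allI impI)
    show "0 < R ^ Suc DIM('a)" using R(1) by simp
    fix P :: "'a problem" and M U t r
    assume sol: "solves_scheme P M U" and en: "energy_bounds P M U E"
      and t: "0 \<le> t" "t \<le> R ^ Suc DIM('a)" "t \<le> final_time P" and r: "r \<in> plate P"
    note sol' = solves_schemeD[OF sol]
    define k where "k = nat \<lfloor>t / step P M\<rfloor>"
    have k_le: "real k \<le> t / step P M"
      using t(1) sol'(5) by (simp add: k_def)
    then have kt: "real k * step P M \<le> t"
      using sol'(5) by (simp add: field_simps)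
    then have "real k * step P M \<le> real (num_steps M) * step P M"
      using t(3) sol'(6) by simp
    then have k: "k \<le> num_steps M" using sol'(5) by simp
    have "\<bar>displ U k r\<bar> * \<kappa> \<le> (real k * step P M / R ^ DIM('a) + R) * B"
      unfolding \<kappa>_def v_def B_def by (rule abs_displ_le[OF dim sol en k r R])
    also have "\<dots> \<le> (R ^ Suc DIM('a) / R ^ DIM('a) + R) * B"
      using kt t(2) R \<open>0 \<le> B\<close> by (intro mult_right_mono add_right_mono divide_right_mono) auto
    also have "\<dots> = 2 * R * B" using R(1) by simp
    also note RB
    finally show "\<bar>displ_at P M U t r\<bar> \<le> H / 2"
      using \<open>0 < \<kappa>\<close> by (simp add: displ_at_def k_def mult.commute)
  qed
qed

theorem corollary4p10:
  fixes H E :: real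
  assumes "DIM('a::euclidean_space) \<in> {1, 2}" and "0 < H"
  shows
    "(\<forall>(P :: 'a problem) M U \<theta> C \<delta>\<^sub>0 \<delta>\<^sub>1.
        height P = H \<longrightarrow> solves_scheme P M U \<longrightarrow> energy_bounds P M U E \<longrightarrow>
        0 \<le> \<theta> \<longrightarrow> \<theta> < 1/3 \<longrightarrow> 0 < C \<longrightarrow>
        (\<forall>k\<in>{1..num_steps M}.
           Linf_norm (plate P) (\<lambda>r. displ U k r - displ U (k - 1) r) \<le> ereal (C * step P M powr \<theta>)) \<longrightarrow>
        step P M powr \<theta> \<le> \<delta>\<^sub>0 / C \<longrightarrow> 2 * \<delta>\<^sub>0 \<le> \<delta>\<^sub>1 \<longrightarrow>
        (\<forall>k<num_steps M.
           \<delta>\<^sub>1 - H \<le> (INF r\<in>plate P. displ U k r) \<longrightarrow>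
           \<delta>\<^sub>1 - \<delta>\<^sub>0 - H \<le> (INF r\<in>plate P. displ U (k + 1) r))) \<and>
     (\<forall>\<delta>\<^sub>0. 0 < \<delta>\<^sub>0 \<and> \<delta>\<^sub>0 < H / 2 \<longrightarrow>
        (\<exists>T\<^sub>0>0. \<forall>(P :: 'a problem) M U.
           height P = H \<longrightarrow> solves_scheme P M U \<longrightarrow> energy_bounds P M U E \<longrightarrow>
           \<delta>\<^sub>0 - H \<le> (INF (t, r)\<in>({0..T\<^sub>0} \<inter> {0..final_time P}) \<times> plate P. displ_at P M U t r)))"
proof (intro conjI allI impI)
  fix P :: "'a problem" and M U \<theta> C \<delta>\<^sub>0 \<delta>\<^sub>1 k
  assume sol: "solves_scheme P M U" and "0 < C"
    and lip: "\<forall>k\<in>{1..num_steps M}.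
      Linf_norm (plate P) (\<lambda>r. displ U k r - displ U (k - 1) r) \<le> ereal (C * step P M powr \<theta>)"
    and small: "step P M powr \<theta> \<le> \<delta>\<^sub>0 / C" and k: "k < num_steps M"
    and low: "\<delta>\<^sub>1 - H \<le> (INF r\<in>plate P. displ U k r)"
  have "Linf_norm (plate P) (\<lambda>r. displ U (Suc k) r - displ U k r) \<le> ereal (C * step P M powr \<theta>)"
    using lip[rule_format, of "Suc k"] k by simp
  also have "\<dots> \<le> ereal \<delta>\<^sub>0"
    using small \<open>0 < C\<close> by (simp add: field_simps)
  finally have "\<delta>\<^sub>1 - H - \<delta>\<^sub>0 \<le> (INF r\<in>plate P. displ U (Suc k) r)"
    by (rule displ_step_lower_bound[OF sol k _ low])
  then show "\<delta>\<^sub>1 - \<delta>\<^sub>0 - H \<le> (INF r\<in>plate P. displ U (k + 1) r)" by (simp add: algebra_simps)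
next
  fix \<delta>\<^sub>0 :: real
  assume \<delta>\<^sub>0: "0 < \<delta>\<^sub>0 \<and> \<delta>\<^sub>0 < H / 2"
  have "DIM('a) \<le> 2" using assms(1) by auto
  then obtain T\<^sub>0 where "0 < T\<^sub>0" and T\<^sub>0: "\<And>(P :: 'a problem) M U t r.
      \<lbrakk>solves_scheme P M U; energy_bounds P M U E; 0 \<le> t; t \<le> T\<^sub>0; t \<le> final_time P; r \<in> plate P\<rbrakk>
      \<Longrightarrow> \<bar>displ_at P M U t r\<bar> \<le> H / 2"
    using uniform_no_contact_time[OF _ \<open>0 < H\<close>, where 'a='a and E=E] by metis
  have "\<delta>\<^sub>0 - H \<le> (INF (t, r)\<in>({0..T\<^sub>0} \<inter> {0..final_time P}) \<times> plate P. displ_at P M U t r)"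
    if sol: "solves_scheme P M U" and en: "energy_bounds P M U E" for P :: "'a problem" and M U
  proof (rule cINF_greatest)
    have "0 < final_time P" "plate P \<noteq> {}"
      using solves_schemeD(1)[OF sol] plate_properties(4) by (auto simp: admissible_problem_def)
    then show "({0..T\<^sub>0} \<inter> {0..final_time P}) \<times> plate P \<noteq> {}"
      using \<open>0 < T\<^sub>0\<close> by (auto intro!: exI[of _ 0])
    fix x assume "x \<in> ({0..T\<^sub>0} \<inter> {0..final_time P}) \<times> plate P"
    then show "\<delta>\<^sub>0 - H \<le> (case x of (t, r) \<Rightarrow> displ_at P M U t r)"
      using T\<^sub>0[OF sol en, of "fst x" "snd x"] \<delta>\<^sub>0 by (auto simp: case_prod_beta abs_le_iff)
  qed
  then show "\<exists>T\<^sub>0>0. \<forall>(P :: 'a problem) M U.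
      height P = H \<longrightarrow> solves_scheme P M U \<longrightarrow> energy_bounds P M U E \<longrightarrow>
      \<delta>\<^sub>0 - H \<le> (INF (t, r)\<in>({0..T\<^sub>0} \<inter> {0..final_time P}) \<times> plate P. displ_at P M U t r)"
    using \<open>0 < T\<^sub>0\<close> by blast
qed

end
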